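(* The problem DiTGR restricted to instances $(G,D,\Delta)$ with period $\Delta=2$, with $G=(V,E)$ a directed geodetic graph, and with $D_{u,v}\in\{\hat d(u,v),\infty\}$ for all $u,v\in V$, can be decided in polynomial time.
   Context: All graphs are finite. A $\Delta$-periodic labeling of a directed graph $G=(V,E)$ is a map $\lambda:E\to\{0,1,\dots,\Delta-1\}$; edge $e$ is then active exactly at the times $\lambda(e)+i\Delta$, $i\in\mathbb{N}_0$. A temporal $s$-$z$-path is a sequence $(v_{i-1},v_i,t_i)_{i=1}^{\ell}$ with $v_0=s$, $v_\ell=z$, pairwise distinct vertices $v_0,\dots,v_\ell$, $(v_{i-1},v_i)\in E$ active at time $t_i$ for every $i$, and $t_1<t_2<\dots<t_\ell$ (strictly increasing). Its duration is $t_\ell+1-t_1$. A fastest temporal path is one of minimum duration. $\hat d(u,v)$ is the distance from $u$ to $v$ in the static graph $G$ (all edges have unit length). A directed graph is geodetic if for every ordered pair of vertices $(u,v)$ the shortest path from $u$ to $v$ is unique. DiTGR: The input is a directed, strongly connected graph $G=(V,E)$, a matrix $D$ indexed by $V\times V$ with entries positive integers or $\infty$ (no restriction) such that $D_{u,v}\ge\hat d(u,v)$ for all $u,v$, and a positive integer $\Delta$. The question is whether there is a $\Delta$-periodic labeling $\lambda$ of $E$ such that, for all $u,v\in V$, the duration of a fastest temporal path from $u$ to $v$ is at most $D_{u,v}$. Diagonal entries of $D$ play no role; all conditions on $D$ are for distinct vertices. Antiparallel edges may get different labels. *)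

theory Defs
  imports
    "Graph_Theory.Graph_Theory"
    "HOL-Library.Extended_Nat"
    "HOL-Library.Log_Nat"
    "HOL-Computational_Algebra.Polynomial"
begin

section \<open>Polynomial-time decidability\<close>

text \<open>
  The machine model is the random access machine with the instruction set of Cook and Reckhow
  (1973), on natural-number registers (so subtraction is truncated) and with two halting
  instructions in place of output. Since there is no multiplication, the contents of a register
  grow by at most one bit per step, up to the constants of the program and the numbers in the
  input. Hence, although every instruction costs one time unit, polynomial time on this machine
  (in the bit length of the input) is polynomial time on Turing machines.
\<close>

datatype instr =
    Const nat nat       \<comment> \<open>\<open>X i := c\<close>\<close>
  | Add nat nat nat     \<comment> \<open>\<open>X i := X j + X k\<close>\<close>
  | Sub nat nat nat     \<comment> \<open>\<open>X i := X j - X k\<close>\<close>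
  | Load nat nat        \<comment> \<open>\<open>X i := X (X j)\<close>\<close>
  | Store nat nat       \<comment> \<open>\<open>X (X i) := X j\<close>\<close>
  | JumpPos nat nat     \<comment> \<open>go to instruction \<open>m\<close> if \<open>X j > 0\<close>\<close>
  | Read nat            \<comment> \<open>\<open>X i :=\<close> next number of the input, \<open>0\<close> if there is none\<close>
  | Halt bool           \<comment> \<open>accept or reject\<close>

text \<open>Program counter, registers, and the part of the input not yet read.\<close>

datatype config = Running nat "nat \<Rightarrow> nat" "nat list" | Halted bool

fun exec :: "instr \<Rightarrow> nat \<Rightarrow> (nat \<Rightarrow> nat) \<Rightarrow> nat list \<Rightarrow> config" where
  "exec (Const i c) pc X xs = Running (Suc pc) (X(i := c)) xs"
| "exec (Add i j k) pc X xs = Running (Suc pc) (X(i := X j + X k)) xs"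
| "exec (Sub i j k) pc X xs = Running (Suc pc) (X(i := X j - X k)) xs"
| "exec (Load i j) pc X xs = Running (Suc pc) (X(i := X (X j))) xs"
| "exec (Store i j) pc X xs = Running (Suc pc) (X(X i := X j)) xs"
| "exec (JumpPos m j) pc X xs = Running (if X j > 0 then m else Suc pc) X xs"
| "exec (Read i) pc X xs =
     (case xs of [] \<Rightarrow> Running (Suc pc) (X(i := 0)) []
               | x # ys \<Rightarrow> Running (Suc pc) (X(i := x)) ys)"
| "exec (Halt b) pc X xs = Halted b"

text \<open>A machine whose program counter leaves the program is stuck and never halts.\<close>

fun step :: "instr list \<Rightarrow> config \<Rightarrow> config" where
  "step P (Running pc X xs) =
     (if pc < length P then exec (P ! pc) pc X xs else Running pc X xs)"
| "step P (Halted b) = Halted b"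

definition initial :: "nat list \<Rightarrow> config" where
  "initial xs = Running 0 (\<lambda>_. 0) xs"

definition halts_within :: "instr list \<Rightarrow> nat list \<Rightarrow> nat \<Rightarrow> bool \<Rightarrow> bool" where
  "halts_within P xs t b \<longleftrightarrow> (step P ^^ t) (initial xs) = Halted b"

text \<open>
  The size of an input is its length in bits: the number \<open>x\<close> has \<open>floorlog 2 x\<close> binary digits,
  and one further symbol per number serves as a separator.
\<close>

definition input_size :: "nat list \<Rightarrow> nat" where
  "input_size xs = (\<Sum>x\<leftarrow>xs. floorlog 2 x + 1)"

text \<open>
  A decision problem is given by its set \<open>I\<close> of instances, of which those satisfying \<open>Y\<close> are the
  yes-instances; \<open>enc\<close> is the encoding of instances as machine inputs.
\<close>

definition poly_time_decidable :: "('i \<Rightarrow> nat list) \<Rightarrow> 'i set \<Rightarrow> ('i \<Rightarrow> bool) \<Rightarrow> bool" where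
  "poly_time_decidable enc I Y \<longleftrightarrow>
     (\<exists>(P :: instr list) (p :: nat poly).
        \<forall>x\<in>I. halts_within P (enc x) (poly p (input_size (enc x))) (Y x))"


section \<open>Static digraphs\<close>

text \<open>A digraph \<open>(V, E)\<close> with \<open>E \<subseteq> V \<times> V\<close> is a \<open>pair_pre_digraph\<close> satisfying \<open>pair_fin_digraph\<close>.\<close>

definition static_dist :: "'a pair_pre_digraph \<Rightarrow> 'a \<Rightarrow> 'a \<Rightarrow> ereal" where
  "static_dist G u v = wf_digraph.\<mu> (with_proj G) (\<lambda>_. 1) u v"

definition shortest_path :: "'a pair_pre_digraph \<Rightarrow> 'a \<Rightarrow> ('a \<times> 'a) list \<Rightarrow> 'a \<Rightarrow> bool" where
  "shortest_path G u p v \<longleftrightarrow>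
     pre_digraph.apath (with_proj G) u p v \<and> ereal (real (length p)) = static_dist G u v"

definition geodetic :: "'a pair_pre_digraph \<Rightarrow> bool" where
  "geodetic G \<longleftrightarrow> (\<forall>u\<in>pverts G. \<forall>v\<in>pverts G. \<exists>!p. shortest_path G u p v)"


section \<open>Periodic labelings and temporal paths\<close>

definition periodic_labeling :: "'a pair_pre_digraph \<Rightarrow> nat \<Rightarrow> ('a \<times> 'a \<Rightarrow> nat) \<Rightarrow> bool" where
  "periodic_labeling G \<Delta> lab \<longleftrightarrow> (\<forall>e\<in>parcs G. lab e < \<Delta>)"

definition active :: "nat \<Rightarrow> ('a \<times> 'a \<Rightarrow> nat) \<Rightarrow> 'a \<times> 'a \<Rightarrow> nat \<Rightarrow> bool" where
  "active \<Delta> lab e t \<longleftrightarrow> (\<exists>i. t = lab e + i * \<Delta>)"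

text \<open>
  The sequence of triples \<open>(v\<^sub>i\<^sub>-\<^sub>1, v\<^sub>i, t\<^sub>i)\<close> is a list of pairs of an arc \<open>(v\<^sub>i\<^sub>-\<^sub>1, v\<^sub>i)\<close> and a
  time \<open>t\<^sub>i\<close>.
\<close>

definition temporal_path ::
  "'a pair_pre_digraph \<Rightarrow> nat \<Rightarrow> ('a \<times> 'a \<Rightarrow> nat) \<Rightarrow> 'a \<Rightarrow> (('a \<times> 'a) \<times> nat) list \<Rightarrow> 'a \<Rightarrow> bool"
where
  "temporal_path G \<Delta> lab s q z \<longleftrightarrow>
     q \<noteq> [] \<and>
     pre_digraph.apath (with_proj G) s (map fst q) z \<and>
     (\<forall>(e, t)\<in>set q. active \<Delta> lab e t) \<and>
     sorted_wrt (<) (map snd q)"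

definition path_duration :: "(('a \<times> 'a) \<times> nat) list \<Rightarrow> nat" where
  "path_duration q = snd (last q) + 1 - snd (hd q)"

definition fastest_duration ::
  "'a pair_pre_digraph \<Rightarrow> nat \<Rightarrow> ('a \<times> 'a \<Rightarrow> nat) \<Rightarrow> 'a \<Rightarrow> 'a \<Rightarrow> enat"
where
  "fastest_duration G \<Delta> lab u v =
     (INF q\<in>{q. temporal_path G \<Delta> lab u q v}. enat (path_duration q))"


section \<open>The problem DiTGR\<close>

record 'a ditgr =
  graph :: "'a pair_pre_digraph"
  bound :: "'a \<Rightarrow> 'a \<Rightarrow> enat"
  period :: nat

definition ditgr_instance :: "'a ditgr \<Rightarrow> bool" where
  "ditgr_instance J \<longleftrightarrow>
     pair_fin_digraph (graph J) \<and>
     strongly_connected (with_proj (graph J)) \<and>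
     (\<forall>u\<in>pverts (graph J). \<forall>v\<in>pverts (graph J). u \<noteq> v \<longrightarrow>
        0 < bound J u v \<and> static_dist (graph J) u v \<le> ereal_of_enat (bound J u v)) \<and>
     0 < period J"

definition ditgr_yes :: "'a ditgr \<Rightarrow> bool" where
  "ditgr_yes J \<longleftrightarrow>
     (\<exists>lab. periodic_labeling (graph J) (period J) lab \<and>
        (\<forall>u\<in>pverts (graph J). \<forall>v\<in>pverts (graph J). u \<noteq> v \<longrightarrow>
           fastest_duration (graph J) (period J) lab u v \<le> bound J u v))"

definition dist_or_infinity :: "'a ditgr \<Rightarrow> bool" where
  "dist_or_infinity J \<longleftrightarrow>
     (\<forall>u\<in>pverts (graph J). \<forall>v\<in>pverts (graph J). u \<noteq> v \<longrightarrow>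
        ereal_of_enat (bound J u v) \<in> {static_dist (graph J) u v, \<infinity>})"

text \<open>
  Machine inputs are instances on an initial segment of the natural numbers: number of vertices,
  adjacency matrix, bound matrix (row by row), period. A finite bound \<open>k\<close> is written as \<open>k + 1\<close>,
  and \<open>\<infinity>\<close> as \<open>0\<close>.
\<close>

definition encode_bound :: "enat \<Rightarrow> nat" where
  "encode_bound d = (case d of enat k \<Rightarrow> Suc k | \<infinity> \<Rightarrow> 0)"

definition encode :: "nat ditgr \<Rightarrow> nat list" where
  "encode J = (let n = card (pverts (graph J)) in
     [n] @
     [if (u, v) \<in> parcs (graph J) then 1 else 0. u \<leftarrow> [0..<n], v \<leftarrow> [0..<n]] @
     [encode_bound (bound J u v). u \<leftarrow> [0..<n], v \<leftarrow> [0..<n]] @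
     [period J])"

definition DiTGR :: "nat ditgr set" where
  "DiTGR = {J. ditgr_instance J \<and> (\<exists>n. pverts (graph J) = {0..<n})}"

end

theory Submission
  imports Defs
begin

text \<open>
  A temporal path has strictly increasing times, so a path from \<open>u\<close> to \<open>v\<close> of duration \<open>d(u, v)\<close>
  is a shortest path whose edges are used at consecutive times. For period 2 this says that the
  labels alternate along the path. As shortest paths are unique, an instance is a yes-instance iff
  the edges can be 2-coloured such that consecutive edges \<open>(a, b)\<close>, \<open>(b, c)\<close> on the shortest path
  of a pair with finite bound get different colours, and these are the edges with
  \<open>d(u, a) + 2 + d(c, v) = d(u, v)\<close>. The machine computes the distances by repeated relaxation and
  then tests 2-colourability by merging classes of edges whose colours determine each other.

  The machine program is compiled from a small loop language with random-access arrays, in which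
  every program terminates and running times have a syntactic polynomial bound.
\<close>

section \<open>Loop programs and their compilation\<close>

text \<open>Geodeticity removes a choice: with several shortest paths, a finite bound would ask that
  one of them alternates, a disjunction. With a single one, finite bounds amount to a conjunction of
  binary constraints. The starting time is free, so alternation is all that matters. The machine has
  neither multiplication nor structured control flow, and one polynomial must bound its running
  time. Loops over limits that their bodies cannot change give termination and the bound together.
  This shapes the algorithm: each constraint is handled by a sweep over all labels instead of a
  graph search, and distances come from a fixed number of rounds. All loop limits are at most
  \<open>pair_code n n\<close>, which is 4n^2 + n.\<close>

datatype com =
    Assign nat nat
  | Plus nat nat nat
  | Minus nat nat nat
  | Get nat nat nat
  | Put nat nat nat
  | Input nat
  | Seq com com (infixr ";;" 60)
  | When nat com
  | Loop nat nat com

type_synonym store = "(nat \<Rightarrow> nat) \<times> (nat \<Rightarrow> nat \<Rightarrow> nat) \<times> nat list"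

fun set_reg :: "nat \<Rightarrow> nat \<Rightarrow> store \<Rightarrow> store" where
  "set_reg x v (s, m, xs) = (s(x := v), m, xs)"

primrec run :: "com \<Rightarrow> store \<Rightarrow> store" where
  "run (Assign x c) \<sigma> = set_reg x c \<sigma>"
| "run (Plus x y z) \<sigma> = set_reg x (fst \<sigma> y + fst \<sigma> z) \<sigma>"
| "run (Minus x y z) \<sigma> = set_reg x (fst \<sigma> y - fst \<sigma> z) \<sigma>"
| "run (Get x k y) \<sigma> = set_reg x (fst (snd \<sigma>) k (fst \<sigma> y)) \<sigma>"
| "run (Put k y x) \<sigma> = (case \<sigma> of (s, m, xs) \<Rightarrow> (s, m(k := (m k)(s y := s x)), xs))"
| "run (Input x) \<sigma> = (case \<sigma> of (s, m, xs) \<Rightarrow>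
     (s(x := (if xs = [] then 0 else hd xs)), m, tl xs))"
| "run (Seq c d) \<sigma> = run d (run c \<sigma>)"
| "run (When x c) \<sigma> = (if fst \<sigma> x > 0 then run c \<sigma> else \<sigma>)"
| "run (Loop x y c) \<sigma> =
     set_reg x (fst \<sigma> y) (fold (\<lambda>k \<tau>. run c (set_reg x k \<tau>)) [0..<fst \<sigma> y] \<sigma>)"

text \<open>
  The set \<open>R\<close> collects the registers that \<open>c\<close> does not write and that may serve as loop limits;
  the variable of a loop joins it inside the body, so that a common bound on the limits at entry
  bounds all limits. Registers from 60 on are scratch space of the compiled code.
\<close>

primrec static :: "nat set \<Rightarrow> com \<Rightarrow> bool" where
  "static R (Assign x c) \<longleftrightarrow> x \<notin> R \<and> x < 60"
| "static R (Plus x y z) \<longleftrightarrow> x \<notin> R \<and> x < 60 \<and> y < 60 \<and> z < 60"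
| "static R (Minus x y z) \<longleftrightarrow> x \<notin> R \<and> x < 60 \<and> y < 60 \<and> z < 60"
| "static R (Get x k y) \<longleftrightarrow> x \<notin> R \<and> x < 60 \<and> k < 4 \<and> y < 60"
| "static R (Put k y x) \<longleftrightarrow> x < 60 \<and> k < 4 \<and> y < 60"
| "static R (Input x) \<longleftrightarrow> x \<notin> R \<and> x < 60"
| "static R (Seq c d) \<longleftrightarrow> static R c \<and> static R d"
| "static R (When x c) \<longleftrightarrow> x < 60 \<and> static R c"
| "static R (Loop x y c) \<longleftrightarrow> x \<notin> R \<and> x < 60 \<and> y \<in> R \<and> y < 60 \<and> static (insert x R) c"

text \<open>An array access takes four steps for the address and one for the transfer, a failing
  \<open>When\<close> three. Each loop iteration spends two steps on the test and three on the
  increment and the jump back; the final 5 covers the initialisation and the failing test.\<close>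

primrec time_bound :: "com \<Rightarrow> nat \<Rightarrow> nat" where
  "time_bound (Assign x c) N = 1"
| "time_bound (Plus x y z) N = 1"
| "time_bound (Minus x y z) N = 1"
| "time_bound (Get x k y) N = 5"
| "time_bound (Put k y x) N = 5"
| "time_bound (Input x) N = 1"
| "time_bound (Seq c d) N = time_bound c N + time_bound d N"
| "time_bound (When x c) N = time_bound c N + 3"
| "time_bound (Loop x y c) N = N * (time_bound c N + 5) + 5"

text \<open>Cell \<open>p\<close> of array \<open>k\<close> is register \<open>64 + 4 * p + k\<close>: the arrays are interleaved and unbounded.\<close>

definition address :: "nat \<Rightarrow> nat \<Rightarrow> instr list" where
  "address k y = [Add 60 y y, Add 60 60 60, Const 61 (64 + k), Add 60 60 61]"

text \<open>Jump targets are absolute, hence the start address \<open>a\<close>. An unconditional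
  jump is a test of register 60 after storing 1 there, and truncated subtraction makes
  \<open>y - x\<close> positive exactly while iterations are left.\<close>

primrec compile :: "nat \<Rightarrow> com \<Rightarrow> instr list" where
  "compile a (Assign x c) = [Const x c]"
| "compile a (Plus x y z) = [Add x y z]"
| "compile a (Minus x y z) = [Sub x y z]"
| "compile a (Get x k y) = address k y @ [Load x 60]"
| "compile a (Put k y x) = address k y @ [Store 60 x]"
| "compile a (Input x) = [Read x]"
| "compile a (Seq c d) = (let cs = compile a c in cs @ compile (a + length cs) d)"
| "compile a (When x c) = (let cs = compile (a + 3) c in
     [JumpPos (a + 3) x, Const 60 1, JumpPos (a + 3 + length cs) 60] @ cs)"
| "compile a (Loop x y c) = (let cs = compile (a + 5) c in
     [Const x 0, Sub 60 y x, JumpPos (a + 5) 60, Const 60 1, JumpPos (a + 8 + length cs) 60] @ cs @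
     [Const 60 1, Add x x 60, JumpPos (a + 1) 60])"

section \<open>Placement of code fragments and step counting\<close>

definition code_at :: "instr list \<Rightarrow> nat \<Rightarrow> instr list \<Rightarrow> bool" where
  "code_at P a cs \<longleftrightarrow> (\<forall>i<length cs. a + i < length P \<and> P ! (a + i) = cs ! i)"

lemma code_at_Nil [simp]: "code_at P a []"
  by (simp add: code_at_def)

lemma code_at_Cons [simp]:
  "code_at P a (i # cs) \<longleftrightarrow> a < length P \<and> P ! a = i \<and> code_at P (Suc a) cs"
  by (auto simp: code_at_def less_Suc_eq_0_disj)

lemma code_at_append [simp]:
  "code_at P a (cs @ ds) \<longleftrightarrow> code_at P a cs \<and> code_at P (a + length cs) ds"
  by (induction cs arbitrary: a) auto

text \<open>Counting at most \<open>t\<close> steps lets bounds be composed and weakened; the exact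
  count demanded by \<open>halts_within\<close> is recovered at the end, as a halted machine stays
  halted.\<close>

definition reaches :: "instr list \<Rightarrow> nat \<Rightarrow> config \<Rightarrow> config \<Rightarrow> bool" where
  "reaches P t c d \<longleftrightarrow> (\<exists>t'\<le>t. (step P ^^ t') c = d)"

lemma funpow_few: "(f ^^ 2) x = f (f x)" "(f ^^ 3) x = f (f (f x))" "(f ^^ 4) x = f (f (f (f x)))"
  by (simp_all add: eval_nat_numeral)

lemma add_few: "a + 2 = Suc (Suc a)" "a + 3 = Suc (Suc (Suc a))" "a + 4 = Suc (Suc (Suc (Suc a)))"
    "a + 5 = Suc (Suc (Suc (Suc (Suc a))))" "a + 6 = Suc (Suc (Suc (Suc (Suc (Suc a)))))"
    "a + 7 = Suc (Suc (Suc (Suc (Suc (Suc (Suc a))))))"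
    "a + 8 = Suc (Suc (Suc (Suc (Suc (Suc (Suc (Suc a)))))))"
  by simp_all

lemma reaches_refl [simp]: "reaches P t c c"
  unfolding reaches_def by (rule exI[of _ 0]) simp

lemma reaches_trans:
  assumes "reaches P t c d" "reaches P u d e" shows "reaches P (t + u) c e"
proof -
  obtain t' u' where "t' \<le> t" "(step P ^^ t') c = d" "u' \<le> u" "(step P ^^ u') d = e"
    using assms by (auto simp: reaches_def)
  then have "u' + t' \<le> t + u" "(step P ^^ (u' + t')) c = e"
    by (simp_all add: funpow_add)
  then show ?thesis unfolding reaches_def by blast
qed

lemma reaches_mono: "reaches P t c d \<Longrightarrow> t \<le> u \<Longrightarrow> reaches P u c d"
  unfolding reaches_def using order_trans by blast

lemma reaches_funpow: "(step P ^^ t) c = d \<Longrightarrow> t \<le> u \<Longrightarrow> reaches P u c d"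
  unfolding reaches_def by blast

lemma reaches_step: "step P c = d \<Longrightarrow> 0 < t \<Longrightarrow> reaches P t c d"
  unfolding reaches_def by (rule exI[of _ 1]) auto

text \<open>Registers 60 to 63 are left unconstrained, so compiled code may overwrite 60 and 61
  without breaking the correspondence.\<close>

definition represents :: "store \<Rightarrow> (nat \<Rightarrow> nat) \<Rightarrow> nat list \<Rightarrow> bool" where
  "represents \<sigma> X xs \<longleftrightarrow>
     (\<forall>r<60. X r = fst \<sigma> r) \<and> (\<forall>k<4. \<forall>p. X (64 + 4 * p + k) = fst (snd \<sigma>) k p) \<and>
     xs = snd (snd \<sigma>)"

lemma represents_set_reg:
  assumes "represents \<sigma> X xs" "x < 60" "\<And>r. r \<noteq> x \<Longrightarrow> r < 60 \<or> r \<ge> 64 \<Longrightarrow> Y r = X r" "Y x = v"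
  shows "represents (set_reg x v \<sigma>) Y xs"
  using assms by (cases \<sigma>) (auto simp: represents_def)

lemma represents_scratch:
  assumes "represents \<sigma> X xs" "\<And>r. r < 60 \<or> r \<ge> 64 \<Longrightarrow> Y r = X r"
  shows "represents \<sigma> Y xs"
  using assms by (auto simp: represents_def)

lemma run_unwritten: "static R c \<Longrightarrow> r \<in> R \<Longrightarrow> fst (run c \<sigma>) r = fst \<sigma> r"
proof (induction c arbitrary: R \<sigma>)
  case (Loop x y c)
  have "fst (fold (\<lambda>k \<tau>. run c (set_reg x k \<tau>)) ks \<sigma>) r = fst \<sigma> r" for ks
  proof (induction ks arbitrary: \<sigma>)
    case (Cons k ks)
    have "fst (run c (set_reg x k \<sigma>)) r = fst (set_reg x k \<sigma>) r"
      using Loop.prems by (intro Loop.IH[of "insert x R"]) auto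
    then show ?case using Cons Loop.prems by (cases \<sigma>) auto
  qed simp
  then show ?case
    using Loop.prems by (cases "fold (\<lambda>k \<tau>. run c (set_reg x k \<tau>)) [0..<fst \<sigma> y] \<sigma>") (simp, metis fst_conv)
next
  case (Seq c d)
  then show ?case by (metis run.simps(7) static.simps(7))
qed (auto split: prod.splits)

lemma reaches_address:
  assumes "code_at P a (address k y)" "y < 60"
  obtains Y where "reaches P 4 (Running a X xs) (Running (a + 4) Y xs)"
    "Y 60 = 64 + 4 * X y + k" "\<And>r. r < 60 \<or> r \<ge> 64 \<Longrightarrow> Y r = X r"
proof
  let ?Y = "X(60 := 64 + 4 * X y + k, 61 := 64 + k)"
  show "reaches P 4 (Running a X xs) (Running (a + 4) ?Y xs)"
    unfolding reaches_def
    by (rule exI[of _ 4]) (use assms in \<open>auto simp: address_def funpow_few add_few fun_eq_iff\<close>)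
qed auto

text \<open>One \<open>N\<close> serves the whole induction while \<open>R\<close> grows: inside a
  loop, the loop variable stays below a limit that is already at most \<open>N\<close>, and
  registers in \<open>R\<close> keep their entry values.\<close>

theorem compile_correct:
  assumes "code_at P a (compile a c)" "static R c" "\<forall>r\<in>R. fst \<sigma> r \<le> N" "represents \<sigma> X xs"
  shows "\<exists>Y ys. represents (run c \<sigma>) Y ys \<and>
    reaches P (time_bound c N) (Running a X xs) (Running (a + length (compile a c)) Y ys)"
  using assms
proof (induction c arbitrary: a R \<sigma> X xs)
  case (Get x k y)
  obtain Y where Y: "reaches P 4 (Running a X xs) (Running (a + 4) Y xs)"
    "Y 60 = 64 + 4 * X y + k" "\<And>r. r < 60 \<or> r \<ge> 64 \<Longrightarrow> Y r = X r"
    using reaches_address[of P a k y X xs] Get.prems by auto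
  have "reaches P (Suc 0) (Running (a + 4) Y xs) (Running (a + 5) (Y(x := Y (Y 60))) xs)"
    using Get.prems by (intro reaches_step) (auto simp: address_def add_few)
  then have "reaches P 5 (Running a X xs) (Running (a + 5) (Y(x := Y (Y 60))) xs)"
    using reaches_trans[OF Y(1)] by fastforce
  moreover have "represents (run (Get x k y) \<sigma>) (Y(x := Y (Y 60))) xs"
    unfolding run.simps using Get.prems Y
    by (intro represents_set_reg[of _ X]) (auto simp: represents_def)
  moreover have len: "a + length (compile a (Get x k y)) = a + 5" by (simp add: address_def)
  ultimately show ?case unfolding len time_bound.simps by (intro exI conjI)
next
  case (Put k y x)
  obtain Y where Y: "reaches P 4 (Running a X xs) (Running (a + 4) Y xs)"
    "Y 60 = 64 + 4 * X y + k" "\<And>r. r < 60 \<or> r \<ge> 64 \<Longrightarrow> Y r = X r"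
    using reaches_address[of P a k y X xs] Put.prems by auto
  have "reaches P (Suc 0) (Running (a + 4) Y xs) (Running (a + 5) (Y(Y 60 := Y x)) xs)"
    using Put.prems by (intro reaches_step) (auto simp: address_def add_few)
  then have "reaches P 5 (Running a X xs) (Running (a + 5) (Y(Y 60 := Y x)) xs)"
    using reaches_trans[OF Y(1)] by fastforce
  moreover have "represents (run (Put k y x) \<sigma>) (Y(Y 60 := Y x)) xs"
  proof -
    \<comment> \<open>Distinct cells have distinct addresses: the offset from 64 determines the
      index as its quotient by 4 and the array as its remainder.\<close>
    have "k' = k \<and> p = q" if "64 + 4 * p + k' = 64 + 4 * q + k" "k' < 4" "k < 4" for p q k' :: nat
      using that by presburger
    then show ?thesis
      using Put.prems Y by (cases \<sigma>) (auto simp: represents_def)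
  qed
  moreover have len: "a + length (compile a (Put k y x)) = a + 5" by (simp add: address_def)
  ultimately show ?case unfolding len time_bound.simps by (intro exI conjI)
next
  case (Seq c d)
  define b where "b = a + length (compile a c)"
  obtain Y ys where Y: "represents (run c \<sigma>) Y ys"
      "reaches P (time_bound c N) (Running a X xs) (Running b Y ys)"
    using Seq.IH(1)[of a R \<sigma> X xs] Seq.prems by (auto simp: Let_def b_def)
  have "\<forall>r\<in>R. fst (run c \<sigma>) r \<le> N"
    using run_unwritten[of R c _ \<sigma>] Seq.prems by auto
  then obtain Z zs where "represents (run d (run c \<sigma>)) Z zs"
      "reaches P (time_bound d N) (Running b Y ys) (Running (b + length (compile b d)) Z zs)"
    using Seq.IH(2)[of b R "run c \<sigma>" Y ys] Seq.prems Y(1) by (auto simp: Let_def b_def)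
  then show ?case
    using reaches_trans[OF Y(2)] by (auto simp: Let_def b_def add.assoc)
next
  case (When x c)
  have len: "a + length (compile a (When x c)) = a + 3 + length (compile (a + 3) c)"
    by (simp add: Let_def)
  have code: "a + 2 < length P" "P ! a = JumpPos (a + 3) x" "P ! (a + 1) = Const 60 1"
      "P ! (a + 2) = JumpPos (a + 3 + length (compile (a + 3) c)) 60"
      "code_at P (a + 3) (compile (a + 3) c)"
    using When.prems(1) by (simp_all add: Let_def add_few)
  have x: "x < 60" "static R c" "X x = fst \<sigma> x"
    using When.prems by (simp_all add: represents_def)
  show ?case
  proof (cases "fst \<sigma> x > 0")
    case True
    obtain Y ys where Y: "represents (run c \<sigma>) Y ys"
      "reaches P (time_bound c N) (Running (a + 3) X xs)
         (Running (a + 3 + length (compile (a + 3) c)) Y ys)"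
      using When.IH[OF code(5) x(2) When.prems(3,4)] by blast
    have "reaches P 3 (Running a X xs) (Running (a + 3) X xs)"
      using code x True by (intro reaches_step) simp_all
    from reaches_trans[OF this Y(2)]
    have "reaches P (time_bound (When x c) N) (Running a X xs)
        (Running (a + 3 + length (compile (a + 3) c)) Y ys)"
      by (simp add: algebra_simps)
    moreover have run: "run (When x c) \<sigma> = run c \<sigma>" using True by simp
    ultimately show ?thesis unfolding len run using Y(1) by (intro exI conjI)
  next
    case False
    have "(step P ^^ 3) (Running a X xs) =
        Running (a + 3 + length (compile (a + 3) c)) (X(60 := 1)) xs"
      using code x False by (simp add: funpow_few add_few)
    then have "reaches P (time_bound (When x c) N) (Running a X xs)
        (Running (a + 3 + length (compile (a + 3) c)) (X(60 := 1)) xs)"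
      by (rule reaches_funpow) simp
    moreover have "represents \<sigma> (X(60 := 1)) xs"
      by (rule represents_scratch[OF When.prems(4)]) auto
    moreover have run: "run (When x c) \<sigma> = \<sigma>" using False by simp
    ultimately show ?thesis unfolding len run by (intro exI conjI)
  qed
next
  case (Loop x y c)
  define cs where "cs = compile (a + 5) c"
  define M where "M = fst \<sigma> y"
  define acc where "acc k = fold (\<lambda>k \<tau>. run c (set_reg x k \<tau>)) [0..<k] \<sigma>" for k
  have code: "a + 7 + length cs < length P" "P ! a = Const x 0"
      "P ! (a + 1) = Sub 60 y x" "P ! (a + 2) = JumpPos (a + 5) 60"
      "P ! (a + 3) = Const 60 1" "P ! (a + 4) = JumpPos (a + 8 + length cs) 60"
      "code_at P (a + 5) cs" "P ! (a + 5 + length cs) = Const 60 1"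
      "P ! (a + 6 + length cs) = Add x x 60" "P ! (a + 7 + length cs) = JumpPos (a + 1) 60"
    using Loop.prems(1) by (auto simp: Let_def cs_def funpow_few add_few)
  have xy: "x < 60" "y < 60" "x \<notin> R" "y \<in> R" "x \<noteq> y" "static (insert x R) c" "M \<le> N"
    using Loop.prems by (auto simp: M_def)
  have acc_R: "fst (acc k) r = fst \<sigma> r" if "r \<in> R" for k r
  proof (induction k)
    case (Suc k)
    have "fst (run c (set_reg x k (acc k))) r = fst (set_reg x k (acc k)) r"
      using xy that by (intro run_unwritten[of "insert x R"]) auto
    then show ?case using Suc xy that by (cases "acc k") (auto simp: acc_def)
  qed (simp add: acc_def)
  have reg_x: "fst (set_reg x k \<tau>) x = k" for k \<tau> by (cases \<tau>) simp
  have reg_R: "fst (set_reg x k \<tau>) r = fst \<tau> r" if "r \<in> R" for k \<tau> r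
    using that xy by (cases \<tau>) auto
  have set_set: "set_reg x k (set_reg x l \<tau>) = set_reg x k \<tau>" for k l \<tau> by (cases \<tau>) simp
  \<comment> \<open>The invariant is attached to the loop test at \<open>a + 1\<close>, where the
    register \<open>x\<close> holds the number \<open>k\<close> of completed iterations; the leading
    1 is the initialisation of \<open>x\<close>.\<close>
  have iter: "\<exists>Y ys. represents (set_reg x k (acc k)) Y ys \<and>
      reaches P (1 + k * (time_bound c N + 5)) (Running a X xs) (Running (a + 1) Y ys)"
    if "k \<le> M" for k
    using that
  proof (induction k)
    case 0
    have "reaches P (Suc 0) (Running a X xs) (Running (a + 1) (X(x := 0)) xs)"
      using code(1,2) by (intro reaches_step) auto
    moreover have "represents (set_reg x 0 (acc 0)) (X(x := 0)) xs"
      using xy Loop.prems by (intro represents_set_reg[of _ X]) (auto simp: acc_def)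
    ultimately show ?case by auto
  next
    case (Suc k)
    then obtain Y ys where Y: "represents (set_reg x k (acc k)) Y ys"
      "reaches P (1 + k * (time_bound c N + 5)) (Running a X xs) (Running (a + 1) Y ys)"
      by auto
    have Yxy: "Y x = k" "Y y = M"
      using Y(1) xy reg_x acc_R reg_R by (auto simp: represents_def M_def)
    define Y' where "Y' = Y(60 := M - k)"
    have "(step P ^^ 2) (Running (a + 1) Y ys) = Running (a + 5) Y' ys"
      using code(1,3,4) Suc.prems Yxy by (simp add: funpow_few add_few Y'_def)
    then have 1: "reaches P 2 (Running (a + 1) Y ys) (Running (a + 5) Y' ys)"
      unfolding reaches_def by blast
    have Y': "represents (set_reg x k (acc k)) Y' ys"
      using Y(1) by (rule represents_scratch) (auto simp: Y'_def)
    have "\<forall>r\<in>insert x R. fst (set_reg x k (acc k)) r \<le> N"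
      using reg_x reg_R acc_R Loop.prems xy Suc.prems by auto
    from Loop.IH[OF code(7)[unfolded cs_def] xy(6) this Y'] obtain Z zs where
      Z: "represents (acc (Suc k)) Z zs" "reaches P (time_bound c N) (Running (a + 5) Y' ys)
        (Running (a + 5 + length cs) Z zs)"
      by (auto simp: cs_def acc_def)
    \<comment> \<open>The body is checked against \<open>insert x R\<close> and cannot write
      \<open>x\<close>, so incrementing the register afterwards gives the next index.\<close>
    have "fst (acc (Suc k)) x = k"
      using run_unwritten[OF xy(6), of x] reg_x by (simp add: acc_def)
    then have Zx: "Z x = k" using Z(1) xy by (auto simp: represents_def)
    define Z' where "Z' = Z(60 := 1, x := Suc k)"
    have "(step P ^^ 3) (Running (a + 5 + length cs) Z zs) = Running (a + 1) Z' zs"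
      using code(1,8-10) Zx xy by (simp add: funpow_few add_few Z'_def)
    then have 3: "reaches P 3 (Running (a + 5 + length cs) Z zs) (Running (a + 1) Z' zs)"
      unfolding reaches_def by blast
    have "represents (set_reg x (Suc k) (acc (Suc k))) Z' zs"
      using Z(1) xy by (intro represents_set_reg[of _ Z]) (auto simp: Z'_def)
    moreover have "reaches P (1 + Suc k * (time_bound c N + 5)) (Running a X xs)
        (Running (a + 1) Z' zs)"
      using reaches_trans[OF Y(2) reaches_trans[OF 1 reaches_trans[OF Z(2) 3]]]
      by (simp add: algebra_simps)
    ultimately show ?case by blast
  qed
  then obtain Y ys where Y: "represents (set_reg x M (acc M)) Y ys"
      "reaches P (1 + M * (time_bound c N + 5)) (Running a X xs) (Running (a + 1) Y ys)"
    by blast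
  have "Y x = M" "Y y = M"
    using Y(1) xy reg_x acc_R reg_R by (auto simp: represents_def M_def)
  then have "(step P ^^ 4) (Running (a + 1) Y ys) = Running (a + 8 + length cs) (Y(60 := 1)) ys"
    using code(1,3-6) by (simp add: funpow_few add_few fun_eq_iff)
  then have 4: "reaches P 4 (Running (a + 1) Y ys) (Running (a + 8 + length cs) (Y(60 := 1)) ys)"
    unfolding reaches_def by blast
  have "1 + M * (time_bound c N + 5) + 4 \<le> time_bound (Loop x y c) N"
    using xy by simp
  then have "reaches P (time_bound (Loop x y c) N) (Running a X xs)
      (Running (a + 8 + length cs) (Y(60 := 1)) ys)"
    using reaches_mono[OF reaches_trans[OF Y(2) 4]] by blast
  moreover have "represents (set_reg x M (acc M)) (Y(60 := 1)) ys"
    using Y(1) by (rule represents_scratch) auto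
  moreover have len: "a + length (compile a (Loop x y c)) = a + 8 + length cs"
    by (simp add: Let_def cs_def)
  moreover have run: "run (Loop x y c) \<sigma> = set_reg x M (acc M)"
    by (simp add: acc_def M_def)
  ultimately show ?case unfolding len run by (intro exI conjI)
next
  case (Assign x v)
  then show ?case
    by (intro exI[of _ "X(x := v)"] exI[of _ xs] conjI reaches_step)
      (auto intro: represents_set_reg)
next
  case (Plus x y z)
  then show ?case
    by (cases \<sigma>, intro exI[of _ "X(x := X y + X z)"] exI[of _ xs] conjI reaches_step)
      (auto simp: represents_def)
next
  case (Minus x y z)
  then show ?case
    by (cases \<sigma>, intro exI[of _ "X(x := X y - X z)"] exI[of _ xs] conjI reaches_step)
      (auto simp: represents_def)
next
  case (Input x)
  then show ?case
    by (intro exI[of _ "X(x := (if xs = [] then 0 else hd xs))"] exI[of _ "tl xs"] conjI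
        reaches_step)
      (auto simp: represents_def neq_Nil_conv split: list.splits prod.splits)
qed

lemma time_bound_poly: "\<exists>p :: nat poly. \<forall>N. poly p N = time_bound c N"
proof (induction c)
  case (Seq c d)
  then obtain p q :: "nat poly" where "\<forall>N. poly p N = time_bound c N" "\<forall>N. poly q N = time_bound d N"
    by blast
  then show ?case by (intro exI[of _ "p + q"]) simp
next
  case (When x c)
  then obtain p :: "nat poly" where "\<forall>N. poly p N = time_bound c N" by blast
  then show ?case by (intro exI[of _ "p + [:3:]"]) simp
next
  case (Loop x y c)
  then obtain p :: "nat poly" where "\<forall>N. poly p N = time_bound c N" by blast
  then show ?case by (intro exI[of _ "[:0, 1:] * (p + [:5:]) + [:5:]"]) simp
qed (auto intro: exI[of _ "[:1:]"] exI[of _ "[:5:]"])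

section \<open>Shortest walks and forced pairs\<close>

text \<open>A natural-number counterpart of \<open>static_dist\<close>, suited to equations that a
  machine can test. For unreachable \<open>v\<close> the \<open>LEAST\<close> has no witness and its
  value is unspecified, hence the reachability hypotheses below.\<close>

definition hops :: "'a pair_pre_digraph \<Rightarrow> 'a \<Rightarrow> 'a \<Rightarrow> nat" where
  "hops G u v = (LEAST l. \<exists>p. pre_digraph.awalk (with_proj G) u p v \<and> length p = l)"

context pair_fin_digraph
begin

lemma awalk_cost_unit: "awalk_cost (\<lambda>_. 1) p = real (length p)"
  by (induction p) auto

lemma hops_le: "awalk u p v \<Longrightarrow> hops G u v \<le> length p"
  unfolding hops_def by (intro Least_le) auto

lemma hops_self: "u \<in> pverts G \<Longrightarrow> hops G u u = 0"
  using hops_le[of u "[]" u] by (simp add: awalk_Nil_iff)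

lemma hops_arc_le: "(u, v) \<in> parcs G \<Longrightarrow> hops G u v \<le> 1"
  using hops_le[of u "[(u, v)]" v] arc_implies_awalk[of "(u, v)"] by simp

lemma ex_shortest_apath:
  assumes "u \<rightarrow>\<^sup>*\<^bsub>with_proj G\<^esub> v"
  shows "\<exists>p. apath u p v \<and> length p = hops G u v \<and> static_dist G u v = ereal (real (hops G u v))"
proof -
  obtain p where p: "apath u p v" "\<mu> (\<lambda>_. 1) u v = ereal (real (length p))"
    using min_cost_awalk[OF assms, of "\<lambda>_. 1"] awalk_cost_unit by auto
  have "length p \<le> length q" if "awalk u q v" for q
    using min_cost_le_walk_cost[OF that, of "\<lambda>_. 1"] p(2) awalk_cost_unit by simp
  then have "hops G u v = length p"
    unfolding hops_def using p(1) by (intro Least_equality) (auto simp: apath_def)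
  with p show ?thesis by (auto simp: static_dist_def)
qed

text \<open>A walk of minimum length repeats no vertex, since cutting out the closed part would
  shorten it. Walks can thus be concatenated without checking distinctness.\<close>

lemma shortest_path_iff:
  assumes "u \<rightarrow>\<^sup>*\<^bsub>with_proj G\<^esub> v"
  shows "shortest_path G u p v \<longleftrightarrow> awalk u p v \<and> length p = hops G u v"
proof
  assume "shortest_path G u p v"
  then show "awalk u p v \<and> length p = hops G u v"
    using ex_shortest_apath[OF assms] by (auto simp: shortest_path_def apath_def)
next
  assume p: "awalk u p v \<and> length p = hops G u v"
  have "distinct (awalk_verts u p)"
  proof (rule ccontr)
    assume "\<not> distinct (awalk_verts u p)"
    then obtain q r s w where qrs: "p = q @ r @ s" "r \<noteq> []" "awalk u q w" "awalk w s v"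
      using awalk_not_distinct_decomp[of u p v] p by blast
    have "hops G u v \<le> length (q @ s)" using awalk_appendI[OF qrs(3,4)] by (rule hops_le)
    then show False using qrs(1,2) p by (cases r) auto
  qed
  then show "shortest_path G u p v"
    using p ex_shortest_apath[OF assms] by (auto simp: shortest_path_def apath_def)
qed

lemma hops_triangle:
  assumes "u \<rightarrow>\<^sup>*\<^bsub>with_proj G\<^esub> w" "w \<rightarrow>\<^sup>*\<^bsub>with_proj G\<^esub> v"
  shows "hops G u v \<le> hops G u w + hops G w v"
proof -
  obtain p q where "awalk u p w" "length p = hops G u w" "awalk w q v" "length q = hops G w v"
    using ex_shortest_apath assms unfolding apath_def by metis
  then show ?thesis
    using hops_le[of u "p @ q" v] awalk_appendI by fastforce
qed

lemma hops_less_card: "u \<rightarrow>\<^sup>*\<^bsub>with_proj G\<^esub> v \<Longrightarrow> hops G u v < card (pverts G)"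
  using ex_shortest_apath[of u v] length_apath_less[of u _ v] by fastforce

text \<open>Dropping the last arc of a shortest walk leaves a shortest walk. This supplies the
  predecessor that the relaxation rounds rely on.\<close>

lemma hops_SucE:
  assumes "u \<rightarrow>\<^sup>*\<^bsub>with_proj G\<^esub> v" "hops G u v = Suc l"
  obtains w where "(w, v) \<in> parcs G" "u \<rightarrow>\<^sup>*\<^bsub>with_proj G\<^esub> w" "hops G u w = l"
proof -
  obtain p where p: "awalk u p v" "length p = Suc l"
    using ex_shortest_apath[OF assms(1)] assms(2) unfolding apath_def by metis
  then obtain q e where q: "p = q @ [e]" "length q = l" by (cases p rule: rev_cases) auto
  then obtain w where w: "awalk u q w" "e = (w, v)" "e \<in> parcs G"
    using p(1) by (cases e) (auto simp: awalk_Cons_iff awalk_Nil_iff)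
  moreover have "u \<rightarrow>\<^sup>*\<^bsub>with_proj G\<^esub> w" using w(1) reachable_awalkI by blast
  moreover have "hops G u v \<le> hops G u w + 1"
  proof -
    have "w \<rightarrow>\<^sup>*\<^bsub>with_proj G\<^esub> v" using w arc_implies_awalk[of e] reachable_awalkI by fastforce
    then have "hops G u v \<le> hops G u w + hops G w v"
      using hops_triangle \<open>u \<rightarrow>\<^sup>*\<^bsub>with_proj G\<^esub> w\<close> by blast
    then show ?thesis using hops_arc_le[of w v] w by auto
  qed
  ultimately show thesis using that hops_le[of u q w] assms(2) q(2) by fastforce
qed

text \<open>The pieces of the walk around the two arcs bound the outer distances from above, and the
  triangle inequality through \<open>a\<close>, \<open>b\<close>, \<open>c\<close> excludes a
  smaller sum.\<close>

lemma shortest_walk_consecutive: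
  assumes "awalk u p v" "length p = hops G u v" "Suc i < length p"
  shows "\<exists>a b c. p ! i = (a, b) \<and> p ! Suc i = (b, c) \<and> (a, b) \<in> parcs G \<and> (b, c) \<in> parcs G \<and>
    hops G u a + 2 + hops G c v = hops G u v"
proof -
  obtain a b where ab: "p ! i = (a, b)" by (cases "p ! i")
  obtain b' c where bc: "p ! Suc i = (b', c)" by (cases "p ! Suc i")
  have p: "p = take i p @ [(a, b), (b', c)] @ drop (Suc (Suc i)) p"
    using assms(3) ab bc id_take_nth_drop[of i p] Cons_nth_drop_Suc[of "Suc i" p] by simp
  have "awalk u (take i p @ [(a, b), (b', c)] @ drop (Suc (Suc i)) p) v"
    using assms(1) p by simp
  then have *: "awalk u (take i p) a" "b' = b" "(a, b) \<in> parcs G" "(b, c) \<in> parcs G"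
      "awalk c (drop (Suc (Suc i)) p) v"
    by (auto simp: awalk_Cons_iff)
  have "hops G u a + hops G c v + 2 \<le> hops G u v"
    using hops_le[OF *(1)] hops_le[OF *(5)] assms by simp
  moreover have "hops G u v \<le> hops G u a + (2 + hops G c v)"
  proof -
    have r: "u \<rightarrow>\<^sup>*\<^bsub>with_proj G\<^esub> a" "a \<rightarrow>\<^sup>*\<^bsub>with_proj G\<^esub> b" "b \<rightarrow>\<^sup>*\<^bsub>with_proj G\<^esub> c" "c \<rightarrow>\<^sup>*\<^bsub>with_proj G\<^esub> v"
      using * arc_implies_awalk[of "(a, b)"] arc_implies_awalk[of "(b, c)"]
      by (auto intro: reachable_awalkI)
    have "hops G a b \<le> 1" "hops G b c \<le> 1" using * hops_arc_le by auto
    then show ?thesis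
      using hops_triangle[OF r(1), of v] hops_triangle[OF r(2), of v] hops_triangle[OF r(3,4)]
        reachable_trans[OF r(3,4)] reachable_trans[OF r(2) reachable_trans[OF r(3,4)]] by linarith
  qed
  ultimately show ?thesis using ab bc *(2-4) by auto
qed

end

section \<open>Labelings of period 2 as colourings of the arcs\<close>

lemma active_2_iff: "lab e < 2 \<Longrightarrow> active 2 lab e t \<longleftrightarrow> t mod 2 = lab e"
  unfolding active_def
proof
  assume "lab e < 2" "t mod 2 = lab e"
  then have "t = lab e + t div 2 * 2" by presburger
  then show "\<exists>i. t = lab e + i * 2" ..
qed auto

lemma strict_sorted_nth_add:
  fixes ts :: "nat list"
  assumes "sorted_wrt (<) ts" "i + k < length ts"
  shows "ts ! i + k \<le> ts ! (i + k)"
  using assms(2)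
proof (induction k)
  case (Suc k)
  then have "ts ! (i + k) < ts ! (i + Suc k)"
    using sorted_wrt_nth_less[OF assms(1), of "i + k" "i + Suc k"] by simp
  with Suc show ?case by simp
qed simp

text \<open>Pairs with \<open>u = v\<close> contribute nothing, as \<open>hops\<close> from
  \<open>u\<close> to itself is 0 and cannot satisfy the equation.\<close>

definition forced_pairs :: "'a ditgr \<Rightarrow> (('a \<times> 'a) \<times> ('a \<times> 'a)) set" where
  "forced_pairs J = {((a, b), (b, c)) | u v a b c.
     u \<in> pverts (graph J) \<and> v \<in> pverts (graph J) \<and> bound J u v \<noteq> \<infinity> \<and>
     (a, b) \<in> parcs (graph J) \<and> (b, c) \<in> parcs (graph J) \<and>
     hops (graph J) u a + 2 + hops (graph J) c v = hops (graph J) u v}"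

text \<open>Given a colouring, a shortest path of a pair with finite bound can be traversed without
  waiting. Conversely, a temporal path meeting the bound is a shortest path, so by uniqueness it
  runs through the two given arcs; having no slack, it uses them at consecutive times, whose
  parities differ.\<close>

theorem ditgr_yes_iff:
  assumes J: "ditgr_instance J" "period J = 2" "geodetic (graph J)" "dist_or_infinity J"
  shows "ditgr_yes J \<longleftrightarrow> (\<exists>col. \<forall>(e, f)\<in>forced_pairs J. col e \<noteq> (col f :: bool))"
proof -
  let ?G = "graph J"
  interpret pair_fin_digraph ?G using J(1) by (simp add: ditgr_instance_def)
  have reach: "u \<rightarrow>\<^sup>*\<^bsub>with_proj ?G\<^esub> v" if "u \<in> pverts ?G" "v \<in> pverts ?G" for u v
    using that J(1) by (auto simp: ditgr_instance_def strongly_connected_def)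
  have bound: "bound J u v = \<infinity> \<or> bound J u v = enat (hops ?G u v)"
    if "u \<in> pverts ?G" "v \<in> pverts ?G" "u \<noteq> v" for u v
  proof -
    have "static_dist ?G u v = ereal (real (hops ?G u v))"
      using ex_shortest_apath[OF reach[OF that(1,2)]] by blast
    moreover have "ereal_of_enat (bound J u v) \<in> {static_dist ?G u v, \<infinity>}"
      using J(4) that unfolding dist_or_infinity_def by blast
    ultimately show ?thesis by (cases "bound J u v") auto
  qed
  show ?thesis
  proof
    assume "\<exists>col. \<forall>(e, f)\<in>forced_pairs J. col e \<noteq> (col f :: bool)"
    then obtain col :: "'a \<times> 'a \<Rightarrow> bool" where col: "\<And>e f. (e, f) \<in> forced_pairs J \<Longrightarrow> col e \<noteq> col f"
      by blast
    define lab where "lab e = (if col e then 1 else 0 :: nat)" for e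
    have lab2: "lab e < 2" for e by (simp add: lab_def)
    have "fastest_duration ?G 2 lab u v \<le> bound J u v"
      if uv: "u \<in> pverts ?G" "v \<in> pverts ?G" "u \<noteq> v" for u v
    proof (cases "bound J u v = \<infinity>")
      case False
      obtain p where p: "apath u p v" "length p = hops ?G u v"
        using ex_shortest_apath[OF reach[OF uv(1,2)]] by blast
      then have p': "awalk u p v" "p \<noteq> []" using uv(3) by (auto simp: apath_def awalk_Nil_iff)
      \<comment> \<open>Starting at the label of the first arc, an active time, and moving on at
        every time unit makes the duration the number of arcs.\<close>
      define t where "t = lab (hd p)"
      define q where "q = zip p [t..<t + length p]"
      have alt: "(t + i) mod 2 = lab (p ! i)" if "i < length p" for i
        using that
      proof (induction i)
        case 0
        then show ?case using p' lab2[of "p ! 0"] by (simp add: t_def hd_conv_nth)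
      next
        case (Suc i)
        obtain a b c where "p ! i = (a, b)" "p ! Suc i = (b, c)" "(a, b) \<in> parcs ?G"
          "(b, c) \<in> parcs ?G" "hops ?G u a + 2 + hops ?G c v = hops ?G u v"
          using shortest_walk_consecutive[OF p'(1) p(2) Suc.prems] by blast
        then have "(p ! i, p ! Suc i) \<in> forced_pairs J"
          using uv False by (auto simp: forced_pairs_def)
        then have "lab (p ! Suc i) = 1 - lab (p ! i)" using col by (auto simp: lab_def)
        moreover have "(t + i) mod 2 = lab (p ! i)" using Suc by simp
        ultimately show ?case by (auto simp: mod_Suc lab_def split: if_splits)
      qed
      have q: "length q = length p" "q \<noteq> []"
        using p'(2) length_0_conv[of q] by (auto simp: q_def)
      have "temporal_path ?G 2 lab u q v"
        unfolding temporal_path_def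
      proof (intro conjI)
        show "q \<noteq> []" using q by auto
        show "apath u (map fst q) v" using p(1) by (simp add: q_def)
        show "sorted_wrt (<) (map snd q)" by (simp add: q_def)
        show "\<forall>(e, t)\<in>set q. active 2 lab e t"
          using alt by (auto simp: q_def set_zip active_2_iff[OF lab2])
      qed
      moreover have "path_duration q = hops ?G u v"
      proof -
        have "snd (q ! i) = t + i" if "i < length p" for i
          using that by (simp add: q_def)
        then show ?thesis
          using q p(2) p'(2) length_greater_0_conv[of p]
          by (simp add: path_duration_def hd_conv_nth last_conv_nth)
      qed
      ultimately have "fastest_duration ?G 2 lab u v \<le> enat (hops ?G u v)"
        unfolding fastest_duration_def by (metis INF_lower mem_Collect_eq)
      then show ?thesis using bound[OF uv] False by simp
    qed simp
    moreover have "periodic_labeling ?G 2 lab" using lab2 by (simp add: periodic_labeling_def)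
    ultimately show "ditgr_yes J" unfolding ditgr_yes_def J(2) by blast
  next
    assume "ditgr_yes J"
    then obtain lab where lab: "periodic_labeling ?G 2 lab"
      "\<And>u v. u \<in> pverts ?G \<Longrightarrow> v \<in> pverts ?G \<Longrightarrow> u \<noteq> v \<Longrightarrow>
         fastest_duration ?G 2 lab u v \<le> bound J u v"
      by (auto simp: ditgr_yes_def J(2))
    have alt: "lab (a, b) \<noteq> lab (b, c)"
      if uv: "u \<in> pverts ?G" "v \<in> pverts ?G" "bound J u v \<noteq> \<infinity>"
        and arcs: "(a, b) \<in> parcs ?G" "(b, c) \<in> parcs ?G"
        and len: "hops ?G u a + 2 + hops ?G c v = hops ?G u v" for u v a b c
    proof -
      have "u \<noteq> v" using hops_self uv(1) len by auto
      have "a \<in> pverts ?G" "c \<in> pverts ?G" using arcs wellformed by fastforce+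
      then obtain p1 p2 where p12: "awalk u p1 a" "length p1 = hops ?G u a"
          "awalk c p2 v" "length p2 = hops ?G c v"
        using ex_shortest_apath[OF reach[OF uv(1)], of a] ex_shortest_apath[OF reach[OF _ uv(2)], of c]
        unfolding apath_def by blast
      define p where "p = p1 @ [(a, b), (b, c)] @ p2"
      have "awalk u p v"
        unfolding p_def using p12 arcs
        by (intro awalk_appendI[OF p12(1)]) (auto simp: awalk_Cons_iff)
      then have p: "shortest_path ?G u p v"
        using shortest_path_iff[OF reach[OF uv(1,2)]] len p12 by (simp add: p_def)
      have "fastest_duration ?G 2 lab u v \<le> enat (hops ?G u v)"
        using lab(2)[OF uv(1,2) \<open>u \<noteq> v\<close>] bound[OF uv(1,2) \<open>u \<noteq> v\<close>] uv(3) by simp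
      \<comment> \<open>A strict bound on an infimum yields a member below it, hence the detour
        through \<open>Suc\<close>.\<close>
      then have "fastest_duration ?G 2 lab u v < enat (Suc (hops ?G u v))"
        by (simp add: order_le_less_trans)
      then obtain q where q: "temporal_path ?G 2 lab u q v" "path_duration q \<le> hops ?G u v"
        unfolding fastest_duration_def INF_less_iff by auto
      have q': "awalk u (map fst q) v" "q \<noteq> []" "sorted_wrt (<) (map snd q)"
        using q(1) by (auto simp: temporal_path_def apath_def)
      have dur: "snd (q ! (length q - 1)) + 1 - snd (q ! 0) \<le> hops ?G u v"
        using q(2) q'(2) by (simp add: path_duration_def last_conv_nth hd_conv_nth)
      have gap: "snd (q ! i) + k \<le> snd (q ! (i + k))" if "i + k < length q" for i k
        using strict_sorted_nth_add[OF q'(3), of i k] that by simp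
      \<comment> \<open>Strictly increasing times make the duration at least the number of arcs,
        which is at least the distance; the bound forces equality throughout.\<close>
      have "hops ?G u v \<le> length q" using hops_le[OF q'(1)] by simp
      then have lenq: "length q = hops ?G u v"
        using gap[of 0 "length q - 1"] dur q'(2) by (cases q) auto
      then have "shortest_path ?G u (map fst q) v"
        using shortest_path_iff[OF reach[OF uv(1,2)]] q' by simp
      then have eq: "map fst q = p"
        using p J(3) uv(1,2) unfolding geodetic_def by blast
      let ?i = "length p1"
      have i: "Suc ?i < length q" using arg_cong[OF eq, of length] by (simp add: p_def)
      \<comment> \<open>Times grow by at least one per arc before and after these two arcs, so a
        larger jump between them would exceed the duration.\<close>
      have "snd (q ! Suc ?i) = Suc (snd (q ! ?i))"
      proof -
        have "Suc ?i + (length q - 1 - Suc ?i) = length q - 1" using i by simp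
        then have "snd (q ! Suc ?i) + (length q - 1 - Suc ?i) \<le> snd (q ! (length q - 1))"
          using gap[of "Suc ?i" "length q - 1 - Suc ?i"] i by simp
        then show ?thesis
          using gap[of 0 ?i] gap[of ?i 1] i dur lenq by simp
      qed
      moreover have "fst (q ! ?i) = (a, b)" "fst (q ! Suc ?i) = (b, c)"
        using i arg_cong[OF eq, of "\<lambda>p. p ! ?i"] arg_cong[OF eq, of "\<lambda>p. p ! Suc ?i"]
        by (simp_all add: p_def nth_append)
      moreover have act: "active 2 lab (fst (q ! j)) (snd (q ! j))" if "j < length q" for j
        using q(1) nth_mem[OF that] by (auto simp: temporal_path_def split_beta)
      ultimately have ab: "active 2 lab (a, b) (snd (q ! ?i))" "active 2 lab (b, c) (Suc (snd (q ! ?i)))"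
        using i act[of ?i] act[of "Suc ?i"] by simp_all
      have lab_ab: "lab (a, b) < 2" "lab (b, c) < 2"
        using lab(1) arcs by (auto simp: periodic_labeling_def)
      have "snd (q ! ?i) mod 2 = lab (a, b)" "Suc (snd (q ! ?i)) mod 2 = lab (b, c)"
        using ab active_2_iff[of lab "(a, b)", OF lab_ab(1)] active_2_iff[of lab "(b, c)", OF lab_ab(2)] by blast+
      then show ?thesis by presburger
    qed
    have lab2: "lab e < 2" if "e \<in> parcs ?G" for e
      using lab(1) that by (simp add: periodic_labeling_def)
    have "lab e \<noteq> lab f \<and> lab e < 2 \<and> lab f < 2" if ef: "(e, f) \<in> forced_pairs J" for e f
    proof -
      obtain u v a b c where "e = (a, b)" "f = (b, c)" "u \<in> pverts ?G" "v \<in> pverts ?G"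
        "bound J u v \<noteq> \<infinity>" "(a, b) \<in> parcs ?G" "(b, c) \<in> parcs ?G"
        "hops ?G u a + 2 + hops ?G c v = hops ?G u v"
        using ef unfolding forced_pairs_def mem_Collect_eq prod.inject by blast
      then show ?thesis using alt lab2 by metis
    qed
    then have "(lab e = 1) \<noteq> (lab f = 1)" if "(e, f) \<in> forced_pairs J" for e f
      using that by (metis less_2_cases One_nat_def)
    then show "\<exists>col. \<forall>(e, f)\<in>forced_pairs J. col e \<noteq> (col f :: bool)"
      by (intro exI[of _ "\<lambda>e. lab e = 1"]) blast
  qed
qed

section \<open>Weakest preconditions and basic programs\<close>

definition wp ::
  "com \<Rightarrow> ((nat \<Rightarrow> nat) \<Rightarrow> (nat \<Rightarrow> nat \<Rightarrow> nat) \<Rightarrow> nat list \<Rightarrow> bool) \<Rightarrow>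
   (nat \<Rightarrow> nat) \<Rightarrow> (nat \<Rightarrow> nat \<Rightarrow> nat) \<Rightarrow> nat list \<Rightarrow> bool"
where
  "wp c Q s m xs \<longleftrightarrow> (case run c (s, m, xs) of (s', m', xs') \<Rightarrow> Q s' m' xs')"

lemma wp_simps [simp]:
  "wp (Assign x v) Q s m xs = Q (s(x := v)) m xs"
  "wp (Plus x y z) Q s m xs = Q (s(x := s y + s z)) m xs"
  "wp (Minus x y z) Q s m xs = Q (s(x := s y - s z)) m xs"
  "wp (Get x k y) Q s m xs = Q (s(x := m k (s y))) m xs"
  "wp (Put k y x) Q s m xs = Q s (m(k := (m k)(s y := s x))) xs"
  "wp (Input x) Q s m xs = Q (s(x := (if xs = [] then 0 else hd xs))) m (tl xs)"
  "wp (c ;; d) Q = wp c (wp d Q)"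
  "wp (When x c) Q s m xs = ((s x > 0 \<longrightarrow> wp c Q s m xs) \<and> (s x = 0 \<longrightarrow> Q s m xs))"
  by (auto simp: wp_def fun_eq_iff split: prod.splits)

lemma wp_mono:
  assumes "wp c Q s m xs" "\<And>s' m' xs'. Q s' m' xs' \<Longrightarrow> Q' s' m' xs'"
  shows "wp c Q' s m xs"
  using assms by (auto simp: wp_def split: prod.splits)

text \<open>The invariant must be insensitive to \<open>x\<close>, which is set before each
  iteration and once more at the end. That registers in \<open>R\<close> keep their values follows
  from \<open>static\<close>, so it is available in the premises without being part of
  \<open>I\<close>.\<close>

lemma wp_Loop:
  assumes "static R (Loop x y c)"
    and "\<And>k s m xs j. I k s m xs \<Longrightarrow> I k (s(x := j)) m xs"
    and "I 0 s m xs"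
    and "\<And>k s' m' xs'. k < s y \<Longrightarrow> \<forall>r\<in>R. s' r = s r \<Longrightarrow> s' x = k \<Longrightarrow> I k s' m' xs' \<Longrightarrow>
           wp c (I (Suc k)) s' m' xs'"
    and "\<And>s' m' xs'. \<forall>r\<in>R. s' r = s r \<Longrightarrow> I (s y) s' m' xs' \<Longrightarrow> Q s' m' xs'"
  shows "wp (Loop x y c) Q s m xs"
proof -
  define acc where "acc k = fold (\<lambda>k \<tau>. run c (set_reg x k \<tau>)) [0..<k] (s, m, xs)" for k
  have x: "x \<notin> R" "static (insert x R) c" using assms(1) by auto
  have acc: "case acc k of (s', m', xs') \<Rightarrow> I k s' m' xs' \<and> (\<forall>r\<in>R. s' r = s r)" if "k \<le> s y" for k
    using that
  proof (induction k)
    case 0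
    then show ?case using assms(3) by (simp add: acc_def)
  next
    case (Suc k)
    obtain s1 m1 xs1 where 1: "acc k = (s1, m1, xs1)" by (cases "acc k")
    obtain s2 m2 xs2 where 2: "acc (Suc k) = (s2, m2, xs2)" by (cases "acc (Suc k)")
    have eq: "run c (s1(x := k), m1, xs1) = (s2, m2, xs2)" using 1 2 by (simp add: acc_def)
    have IH: "I k s1 m1 xs1" "\<forall>r\<in>R. s1 r = s r" using Suc 1 by auto
    then have "wp c (I (Suc k)) (s1(x := k)) m1 xs1"
      using assms(2,4) Suc.prems x(1) by auto
    then have "I (Suc k) s2 m2 xs2" by (simp add: wp_def eq)
    moreover have "\<forall>r\<in>R. s2 r = s r"
      using run_unwritten[OF x(2), of _ "(s1(x := k), m1, xs1)"] eq IH(2) x(1) by auto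
    ultimately show ?case using 2 by simp
  qed
  obtain s' m' xs' where 3: "acc (s y) = (s', m', xs')" by (cases "acc (s y)")
  then have "Q (s'(x := s y)) m' xs'"
    using acc[of "s y"] x(1) by (intro assms(5) assms(2)) auto
  then show ?thesis using 3 by (simp add: wp_def acc_def)
qed

text \<open>Indexing the invariant by the set of items already processed makes nested loops compose:
  an inner loop starts from whatever set \<open>T\<close> the outer ones have accumulated and adds
  its own union.\<close>

lemma wp_Loop_Union:
  assumes "static R (Loop x y c)"
    and "\<And>T s m xs j. P T s m xs \<Longrightarrow> P T (s(x := j)) m xs"
    and "P T s m xs"
    and "\<And>k T s' m' xs'. k < s y \<Longrightarrow> \<forall>r\<in>R. s' r = s r \<Longrightarrow> s' x = k \<Longrightarrow> P T s' m' xs' \<Longrightarrow>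
           wp c (P (T \<union> G k)) s' m' xs'"
  shows "wp (Loop x y c) (P (T \<union> (\<Union>k<s y. G k))) s m xs"
proof (rule wp_Loop[where R = R and I = "\<lambda>k. P (T \<union> (\<Union>k'<k. G k'))"])
  fix k s' m' xs'
  assume "k < s y" "\<forall>r\<in>R. s' r = s r" "s' x = k" "P (T \<union> (\<Union>k'<k. G k')) s' m' xs'"
  from assms(4)[OF this] show "wp c (P (T \<union> (\<Union>k'<Suc k. G k'))) s' m' xs'"
    by (simp add: lessThan_Suc Un_ac)
qed (use assms in auto)

text \<open>
  An injection of all pairs, rather than \<open>i * n + j\<close>, makes array accesses independent of \<open>n\<close>.
\<close>

definition pair_code :: "nat \<Rightarrow> nat \<Rightarrow> nat" where
  "pair_code i j = (i + j) * (i + j) + j"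

text \<open>If \<open>i + j = k\<close>, the code lies between k^2 and k^2 + k, below the square of
  k + 1. So it determines the sum, and then \<open>j\<close>.\<close>

lemma pair_code_inject [simp]: "pair_code i j = pair_code i' j' \<longleftrightarrow> i = i' \<and> j = j'"
proof -
  have less: "pair_code i j < pair_code i' j'" if "i + j < i' + j'" for i j i' j'
  proof -
    have "pair_code i j < Suc (i + j) * Suc (i + j)" by (simp add: pair_code_def)
    also have "\<dots> \<le> (i' + j') * (i' + j')" using that by (intro mult_le_mono) auto
    finally show ?thesis by (simp add: pair_code_def)
  qed
  show ?thesis
  proof
    assume eq: "pair_code i j = pair_code i' j'"
    then have "i + j = i' + j'" using less[of i j i' j'] less[of i' j' i j] by linarith
    with eq show "i = i' \<and> j = j'" by (simp add: pair_code_def)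
  qed simp
qed

lemma pair_code_less: "i < n \<Longrightarrow> j < n \<Longrightarrow> pair_code i j < pair_code n n"
  unfolding pair_code_def by (intro add_le_less_mono mult_le_mono) auto

text \<open>Multiplication by repeated addition: to \<open>j\<close>, the sum \<open>i + j\<close>
  is added \<open>i\<close> times and then \<open>j\<close> times.\<close>

definition Encode_Pair :: "nat \<Rightarrow> nat \<Rightarrow> nat \<Rightarrow> com" where
  "Encode_Pair x i j = Plus 58 i j ;; Assign x 0 ;; Plus x x j ;;
     Loop 59 i (Plus x x 58) ;; Loop 59 j (Plus x x 58)"

lemma wp_Encode_Pair [simp]:
  assumes "x \<noteq> i" "x \<noteq> j" "x < 58" "i < 58" "j < 58"
  shows "wp (Encode_Pair x i j) Q s m xs =
    Q (s(58 := s i + s j, x := pair_code (s i) (s j), 59 := s j)) m xs"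
proof -
  have "fold (\<lambda>k \<tau>. run (Plus x x 58) (set_reg 59 k \<tau>)) [0..<N] (t, m, xs) =
      (t(x := t x + N * t 58, 59 := if N = 0 then t 59 else N - 1), m, xs)" for N t
    using assms by (induction N) (auto simp: fun_eq_iff)
  then have "wp (Loop 59 y (Plus x x 58)) Q t m xs = Q (t(x := t x + t y * t 58, 59 := t y)) m xs"
    for y t Q
    using assms by (simp add: wp_def fun_upd_twist)
  moreover have "pair_code (s i) (s j) = s j + s i * (s i + s j) + s j * (s i + s j)"
    by (simp add: pair_code_def algebra_simps)
  ultimately show ?thesis
    using assms by (simp add: Encode_Pair_def fun_upd_twist)
qed

lemma static_Encode_Pair [simp]:
  "x < 58 \<Longrightarrow> static R (Encode_Pair x i j) \<longleftrightarrow>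
     x \<notin> R \<and> 58 \<notin> R \<and> 59 \<notin> R \<and> i \<in> R \<and> j \<in> R \<and> i < 60 \<and> j < 60"
  by (auto simp: Encode_Pair_def)

text \<open>Both truncated differences vanish only for equal arguments; subtracting their sum from 1
  gives the truth value.\<close>

definition Equal :: "nat \<Rightarrow> nat \<Rightarrow> nat \<Rightarrow> com" where
  "Equal z x y = Minus z x y ;; Minus 57 y x ;; Plus z z 57 ;; Assign 57 1 ;; Minus z 57 z"

lemma wp_Equal [simp]:
  assumes "z \<noteq> x" "z \<noteq> y" "x < 57" "y < 57" "z < 57"
  shows "wp (Equal z x y) Q s m xs = Q (s(57 := 1, z := if s x = s y then 1 else 0)) m xs"
proof -
  have "1 - (s x - s y + (s y - s x)) = (if s x = s y then 1 else 0)" by auto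
  then show ?thesis using assms by (simp add: Equal_def fun_upd_twist)
qed

lemma static_Equal [simp]:
  "x < 57 \<Longrightarrow> y < 57 \<Longrightarrow> z < 57 \<Longrightarrow> static R (Equal z x y) \<longleftrightarrow> z \<notin> R \<and> 57 \<notin> R"
  by (auto simp: Equal_def)

text \<open>
  Register 0 holds the number \<open>n\<close> of vertices, register 7 the bound \<open>N = pair_code n n\<close> on the codes
  of arcs, register 11 holds \<open>2 * N + 1\<close> and register 10 is set once a contradiction is found.
  Arrays 0 and 1 are the input matrices, array 2 the distances and array 3 the labels of the arcs.
\<close>

definition read_matrix :: "nat \<Rightarrow> com" where
  "read_matrix k = Loop 2 0 (Loop 3 0 (Encode_Pair 12 2 3 ;; Input 9 ;; Put k 12 9))"

definition flatten :: "nat \<Rightarrow> (nat \<Rightarrow> nat \<Rightarrow> nat) \<Rightarrow> nat list" where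
  "flatten n f = concat (map (\<lambda>u. map (f u) [0..<n]) [0..<n])"

lemma wp_read_matrix:
  assumes "k < 4" "s 0 = n"
    and xs: "xs = flatten n f @ rest"
    and Q: "\<And>s' m'. \<forall>r\<in>{0, 7, 10, 11}. s' r = s r \<Longrightarrow> \<forall>i<n. \<forall>j<n. m' k (pair_code i j) = f i j \<Longrightarrow>
      \<forall>k'. k' \<noteq> k \<longrightarrow> m' k' = m k' \<Longrightarrow> Q s' m' rest"
  shows "wp (read_matrix k) Q s m xs"
  unfolding read_matrix_def
proof (rule wp_Loop[where R = "{0, 7, 10, 11}" and I = "\<lambda>u s' m' xs'.
      xs' = concat (map (\<lambda>u. map (f u) [0..<n]) [u..<n]) @ rest \<and>
      (\<forall>i<u. \<forall>j<n. m' k (pair_code i j) = f i j) \<and> (\<forall>k'. k' \<noteq> k \<longrightarrow> m' k' = m k')"],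
    goal_cases)
  case (4 u s1 m1 xs1)
  then have u: "u < n" "s1 2 = u" "s1 0 = n" using assms(2) by auto
  show ?case
  proof (rule wp_Loop[where R = "{0, 2, 7, 10, 11}" and I = "\<lambda>v s' m' xs'.
      xs' = map (f u) [v..<n] @ concat (map (\<lambda>u. map (f u) [0..<n]) [Suc u..<n]) @ rest \<and>
      (\<forall>i<u. \<forall>j<n. m' k (pair_code i j) = f i j) \<and> (\<forall>j<v. m' k (pair_code u j) = f u j) \<and>
      (\<forall>k'. k' \<noteq> k \<longrightarrow> m' k' = m k')"], goal_cases)
    case (4 v s2 m2 xs2)
    then show ?case using u by (auto simp: less_Suc_eq upt_conv_Cons)
  qed (use 4 u assms(1) in \<open>auto simp: less_Suc_eq upt_conv_Cons\<close>)
qed (use assms in \<open>auto simp: flatten_def\<close>)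

text \<open>In a strongly connected graph all distances are below \<open>n\<close>, so \<open>n\<close> serves as infinity.\<close>

definition dist_init :: com where
  "dist_init = Loop 2 0 (Loop 3 0 (Encode_Pair 12 2 3 ;; Assign 9 0 ;; Plus 9 9 0 ;; Get 13 0 12 ;;
     When 13 (Assign 9 1) ;; Equal 14 2 3 ;; When 14 (Assign 9 0) ;; Put 2 12 9))"

lemma wp_dist_init:
  assumes "s 0 = n"
    and Q: "\<And>s' m'. \<forall>r\<in>{0, 7, 10, 11}. s' r = s r \<Longrightarrow>
      \<forall>i<n. \<forall>j<n. m' 2 (pair_code i j) = (if i = j then 0 else if m 0 (pair_code i j) > 0 then 1 else n) \<Longrightarrow>
      \<forall>k. k \<noteq> 2 \<longrightarrow> m' k = m k \<Longrightarrow> Q s' m' xs"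
  shows "wp dist_init Q s m xs"
proof -
  define P where "P T s' m' xs' \<longleftrightarrow> (\<forall>r\<in>{0, 7, 10, 11}. s' r = s r) \<and>
    (\<forall>(i, j)\<in>T. m' 2 (pair_code i j) =
      (if i = j then 0 else if m 0 (pair_code i j) > 0 then 1 else n)) \<and>
    (\<forall>k. k \<noteq> 2 \<longrightarrow> m' k = m k) \<and> xs' = xs"
    for T :: "(nat \<times> nat) set" and s' m' and xs' :: "nat list"
  have "wp dist_init (P ({} \<union> (\<Union>u<s 0. \<Union>v<n. {(u, v)}))) s m xs"
    unfolding dist_init_def
  proof (rule wp_Loop_Union[where R = "{0, 7, 10, 11}"], goal_cases)
    case (4 u T s1 m1 xs1)
    then have s1: "s1 0 = n" using assms by simp
    have "wp (Loop 3 0 (Encode_Pair 12 2 3 ;; Assign 9 0 ;; Plus 9 9 0 ;; Get 13 0 12 ;;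
       When 13 (Assign 9 1) ;; Equal 14 2 3 ;; When 14 (Assign 9 0) ;; Put 2 12 9))
      (P (T \<union> (\<Union>v<s1 0. {(u, v)}))) s1 m1 xs1"
    proof (rule wp_Loop_Union[where R = "{0, 2, 7, 10, 11}"], goal_cases)
      case (4 v T' s2 m2 xs2)
      then show ?case using \<open>s1 2 = u\<close> s1 by (auto simp: P_def)
    qed (use 4 in \<open>auto simp: P_def\<close>)
    then show ?case by (simp add: s1)
  qed (auto simp: P_def)
  then show ?thesis
    by (rule wp_mono) (use assms(1) in \<open>auto simp: P_def intro!: Q\<close>)
qed

section \<open>Distances\<close>

text \<open>In-place relaxation over all triples, repeated \<open>n\<close> times. The intermediate
  vertex is the innermost index, so a single pass need not yield the distances; each round is relied
  upon only to settle one further value.\<close>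

definition relax :: com where
  "relax = Loop 2 0 (Loop 3 0 (Loop 4 0 (Loop 5 0 (
     Encode_Pair 12 3 4 ;; Encode_Pair 13 3 5 ;; Encode_Pair 14 5 4 ;; Get 15 2 12 ;; Get 16 2 13 ;; Get 17 2 14 ;;
     Plus 16 16 17 ;; Minus 15 15 16 ;; When 15 (Put 2 12 16)))))"

text \<open>Entries never fall below \<open>d\<close>, and after \<open>r\<close> rounds those with
  \<open>d i j \<le> r + 1\<close> are exact; the shift by one reflects that the initial matrix is
  exact up to distance 1. As \<open>d\<close> stays below \<open>n\<close>, the rounds suffice. An
  abstract \<open>d\<close> keeps graphs out of the program proof.\<close>

lemma wp_relax:
  fixes d :: "nat \<Rightarrow> nat \<Rightarrow> nat"
  assumes "s 0 = n"
    and tri: "\<And>i j k. i < n \<Longrightarrow> j < n \<Longrightarrow> k < n \<Longrightarrow> d i j \<le> d i k + d k j"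
    and split: "\<And>i j l. i < n \<Longrightarrow> j < n \<Longrightarrow> d i j = Suc (Suc l) \<Longrightarrow>
      \<exists>k<n. d i k = Suc l \<and> d k j \<le> 1"
    and less: "\<And>i j. i < n \<Longrightarrow> j < n \<Longrightarrow> d i j < n"
    and init: "\<And>i j. i < n \<Longrightarrow> j < n \<Longrightarrow> d i j \<le> m 2 (pair_code i j) \<and>
      (d i j \<le> 1 \<longrightarrow> m 2 (pair_code i j) = d i j)"
    and Q: "\<And>s' m'. \<forall>r\<in>{0, 7, 10, 11}. s' r = s r \<Longrightarrow>
      \<forall>i<n. \<forall>j<n. m' 2 (pair_code i j) = d i j \<Longrightarrow>
      \<forall>k. k \<noteq> 2 \<longrightarrow> m' k = m k \<Longrightarrow> Q s' m' xs"
  shows "wp relax Q s m xs"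
  unfolding relax_def
proof (rule wp_Loop[where R = "{0, 7, 10, 11}" and I = "\<lambda>r s' m' xs'.
      (\<forall>i<n. \<forall>j<n. d i j \<le> m' 2 (pair_code i j) \<and>
         (d i j \<le> Suc r \<longrightarrow> m' 2 (pair_code i j) = d i j)) \<and>
      (\<forall>k. k \<noteq> 2 \<longrightarrow> m' k = m k) \<and> xs' = xs"], goal_cases)
  case (4 r s1 m1 xs1)
  \<comment> \<open>Progress is measured against \<open>m1\<close>, the matrix at the start of the
    round. Updates only decrease entries, so bounds by sums of old entries persist during the
    round.\<close>
  define P where "P T s' m' xs' \<longleftrightarrow>
    (\<forall>i<n. \<forall>j<n. d i j \<le> m' 2 (pair_code i j) \<and> m' 2 (pair_code i j) \<le> m1 2 (pair_code i j)) \<and>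
    (\<forall>(i, j, k)\<in>T. m' 2 (pair_code i j) \<le> m1 2 (pair_code i k) + m1 2 (pair_code k j)) \<and>
    (\<forall>k. k \<noteq> 2 \<longrightarrow> m' k = m k) \<and> xs' = xs"
    for T :: "(nat \<times> nat \<times> nat) set" and s' :: "nat \<Rightarrow> nat" and m' xs'
  note inv = 4
  have s1: "s1 0 = n" using 4 assms(1) by simp
  let ?body = "Encode_Pair 12 3 4 ;; Encode_Pair 13 3 5 ;; Encode_Pair 14 5 4 ;; Get 15 2 12 ;; Get 16 2 13 ;;
    Get 17 2 14 ;; Plus 16 16 17 ;; Minus 15 15 16 ;; When 15 (Put 2 12 16)"
  have "wp (Loop 3 0 (Loop 4 0 (Loop 5 0 ?body)))
      (P ({} \<union> (\<Union>i<s1 0. \<Union>j<n. \<Union>k<n. {(i, j, k)}))) s1 m1 xs1"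
  proof (rule wp_Loop_Union[where R = "{0}"], goal_cases)
    case (4 i T s2 m2 xs2)
    then have s2: "s2 0 = n" "s2 3 = i" "i < n" using s1 by auto
    have "wp (Loop 4 0 (Loop 5 0 ?body)) (P (T \<union> (\<Union>j<s2 0. \<Union>k<n. {(i, j, k)}))) s2 m2 xs2"
    proof (rule wp_Loop_Union[where R = "{0, 3}"], goal_cases)
      case (4 j T' s3 m3 xs3)
      then have s3: "s3 0 = n" "s3 3 = i" "s3 4 = j" "j < n" using s2 by auto
      have "wp (Loop 5 0 ?body) (P (T' \<union> (\<Union>k<s3 0. {(i, j, k)}))) s3 m3 xs3"
      proof (rule wp_Loop_Union[where R = "{0, 3, 4}"], goal_cases)
        case (4 k T'' s4 m4 xs4)
        then have s4: "s4 0 = n" "s4 3 = i" "s4 4 = j" "s4 5 = k" "k < n" using s3 by auto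
        have P4: "P T'' s4 m4 xs4" by fact
        then have D4: "\<And>a b. a < n \<Longrightarrow> b < n \<Longrightarrow> d a b \<le> m4 2 (pair_code a b)"
            "\<And>a b. a < n \<Longrightarrow> b < n \<Longrightarrow> m4 2 (pair_code a b) \<le> m1 2 (pair_code a b)"
            "\<And>a b c. (a, b, c) \<in> T'' \<Longrightarrow>
               m4 2 (pair_code a b) \<le> m1 2 (pair_code a c) + m1 2 (pair_code c b)"
            "\<And>k. k \<noteq> 2 \<Longrightarrow> m4 k = m k" "xs4 = xs"
          unfolding P_def by blast+
        have ijk: "i < n" "j < n" "k < n" using s2(3) s3(4) s4(5) by simp_all
        let ?new = "m4 2 (pair_code i k) + m4 2 (pair_code k j)"
        have new: "d i j \<le> ?new" "?new \<le> m1 2 (pair_code i k) + m1 2 (pair_code k j)"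
          using tri[OF ijk] D4(1,2)[OF ijk(1,3)] D4(1,2)[OF ijk(3,2)] by linarith+
        have P_m': "P (T'' \<union> {(i, j, k)}) t m' xs4"
          if ge: "\<And>a b. a < n \<Longrightarrow> b < n \<Longrightarrow> d a b \<le> m' 2 (pair_code a b)"
            and le: "\<And>p. m' 2 p \<le> m4 2 p" and ij: "m' 2 (pair_code i j) \<le> ?new"
            and other: "\<And>k. k \<noteq> 2 \<Longrightarrow> m' k = m4 k" for t m'
          unfolding P_def
        proof (intro conjI allI impI ballI)
          fix a b assume "a < n" "b < n"
          then show "d a b \<le> m' 2 (pair_code a b)" by (rule ge)
          show "m' 2 (pair_code a b) \<le> m1 2 (pair_code a b)"
            using le D4(2)[OF \<open>a < n\<close> \<open>b < n\<close>] by (rule order_trans)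
        next
          fix x assume x: "x \<in> T'' \<union> {(i, j, k)}"
          obtain a b c where abc: "x = (a, b, c)" by (cases x)
          have "m' 2 (pair_code a b) \<le> m1 2 (pair_code a c) + m1 2 (pair_code c b)"
          proof (cases "(a, b, c) \<in> T''")
            case True
            show ?thesis using le D4(3)[OF True] by (rule order_trans)
          next
            case False
            then show ?thesis using x abc ij new(2) by simp
          qed
          then show "case x of (i, j, k) \<Rightarrow>
              m' 2 (pair_code i j) \<le> m1 2 (pair_code i k) + m1 2 (pair_code k j)"
            by (simp add: abc)
        qed (use D4 other in auto)
        have "P (T'' \<union> {(i, j, k)}) t (m4(2 := (m4 2)(pair_code i j := ?new))) xs4"
          if "?new < m4 2 (pair_code i j)" for t
          using that new(1) D4(1) by (intro P_m') auto
        moreover have "P (T'' \<union> {(i, j, k)}) t m4 xs4"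
          if "m4 2 (pair_code i j) \<le> ?new" for t
          using that D4(1) by (intro P_m') auto
        ultimately show ?case by (simp add: s4)
      qed (use 4 in \<open>auto simp: P_def\<close>)
      then show ?case by (simp add: s3)
    qed (use 4 in \<open>auto simp: P_def\<close>)
    then show ?case by (simp add: s2)
  qed (use 4 in \<open>auto simp: P_def\<close>)
  then show ?case
  proof (rule wp_mono)
    fix s' m' xs'
    assume "P ({} \<union> (\<Union>i<s1 0. \<Union>j<n. \<Union>k<n. {(i, j, k)})) s' m' xs'"
    then have P: "\<And>i j. i < n \<Longrightarrow> j < n \<Longrightarrow> d i j \<le> m' 2 (pair_code i j)"
      "\<And>i j. i < n \<Longrightarrow> j < n \<Longrightarrow> m' 2 (pair_code i j) \<le> m1 2 (pair_code i j)"
      "\<And>i j k. i < n \<Longrightarrow> j < n \<Longrightarrow> k < n \<Longrightarrow>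
         m' 2 (pair_code i j) \<le> m1 2 (pair_code i k) + m1 2 (pair_code k j)"
      "\<forall>k. k \<noteq> 2 \<longrightarrow> m' k = m k" "xs' = xs"
      by (auto simp: P_def s1)
    have eq: "m1 2 (pair_code i j) = d i j" if "i < n" "j < n" "d i j \<le> Suc r" for i j
      using inv that by blast
    have "m' 2 (pair_code i j) = d i j" if ij: "i < n" "j < n" "d i j \<le> Suc (Suc r)" for i j
    proof (cases "d i j \<le> Suc r")
      case True
      then show ?thesis using P(1,2)[OF that(1,2)] eq[OF that(1,2)] by simp
    next
      case False
      then have dij: "d i j = Suc (Suc r)" using that by simp
      \<comment> \<open>Both \<open>d i k\<close> and \<open>d k j\<close> are at most
        \<open>Suc r\<close>, so their entries were exact when the round began.\<close>
      then obtain k where "k < n" "d i k = Suc r" "d k j \<le> 1" using split[OF ij(1,2)] by blast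
      then show ?thesis
        using P(1,3)[of i j] eq[of i k] eq[of k j] that dij by fastforce
    qed
    with P show "(\<forall>i<n. \<forall>j<n. d i j \<le> m' 2 (pair_code i j) \<and>
         (d i j \<le> Suc (Suc r) \<longrightarrow> m' 2 (pair_code i j) = d i j)) \<and>
      (\<forall>k. k \<noteq> 2 \<longrightarrow> m' k = m k) \<and> xs' = xs"
      by blast
  qed
next
  case (5 s' m' xs')
  then have "m' 2 (pair_code i j) = d i j" if "i < n" "j < n" for i j
    using less[OF that] that assms(1) by (metis le_SucI less_imp_le_nat)
  with 5 Q show ?case by blast
qed (use assms in auto)

definition label_init :: com where
  "label_init = Loop 2 7 (Put 3 2 2)"

lemma wp_label_init:
  assumes Q: "\<And>s' m'. \<forall>r\<in>{0, 7, 10, 11}. s' r = s r \<Longrightarrow> \<forall>p<s 7. m' 3 p = p \<Longrightarrow>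
      \<forall>k. k \<noteq> 3 \<longrightarrow> m' k = m k \<Longrightarrow> Q s' m' xs"
  shows "wp label_init Q s m xs"
  unfolding label_init_def
  by (rule wp_Loop[where R = "{0, 7, 10, 11}" and I = "\<lambda>p s' m' xs'.
      (\<forall>q<p. m' 3 q = q) \<and> (\<forall>k. k \<noteq> 3 \<longrightarrow> m' k = m k) \<and> xs' = xs"])
    (auto simp: less_Suc_eq intro!: Q)

section \<open>Merging labels\<close>

text \<open>
  Labels are literals: \<open>2 * N + 1 - z\<close> is the negation of \<open>z\<close>, different from \<open>z\<close> by parity.
\<close>

definition labels_sound :: "nat \<Rightarrow> (nat \<times> nat) set \<Rightarrow> (nat \<Rightarrow> nat) \<Rightarrow> nat \<Rightarrow> bool" where
  "labels_sound N T L flag \<longleftrightarrow>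
     (if flag = 0
      then (\<forall>p<N. L p \<le> 2 * N + 1) \<and> (\<forall>(p, q)\<in>T. p < N \<and> q < N \<and> L p + L q = 2 * N + 1) \<and>
        (\<forall>col :: nat \<Rightarrow> bool. (\<forall>(p, q)\<in>T. col p \<noteq> col q) \<longrightarrow>
           (\<forall>p<N. \<forall>q<N. (L p = L q \<longrightarrow> col p = col q) \<and>
              (L p + L q = 2 * N + 1 \<longrightarrow> col p \<noteq> col q)))
      else \<not> (\<exists>col :: nat \<Rightarrow> bool. \<forall>(p, q)\<in>T. col p \<noteq> col q))"

text \<open>Of two literals with sum \<open>2 * N + 1\<close> exactly one is at most
  \<open>N\<close>; this threshold turns labels into colours.\<close>

lemma labels_sound_final:
  assumes "labels_sound N T L flag"
  shows "flag = 0 \<longleftrightarrow> (\<exists>col :: nat \<Rightarrow> bool. \<forall>(p, q)\<in>T. col p \<noteq> col q)"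
proof (cases "flag = 0")
  case True
  have "(L p \<le> N) \<noteq> (L q \<le> N)" if "(p, q) \<in> T" for p q
  proof -
    have "L p + L q = 2 * N + 1" using assms True that by (auto simp: labels_sound_def)
    then show ?thesis by linarith
  qed
  then have "\<forall>(p, q)\<in>T. (L p \<le> N) \<noteq> (L q \<le> N)" by blast
  then show ?thesis using True by (intro iffI exI[of _ "\<lambda>p. L p \<le> N"]) auto
qed (use assms in \<open>auto simp: labels_sound_def\<close>)

text \<open>The negation of \<open>x\<close> must be replaced along with \<open>x\<close>, or
  complementary labels would get out of step. The negated case is tested first to mirror the
  program, where the second write wins.\<close>

definition substitute :: "nat \<Rightarrow> nat \<Rightarrow> nat \<Rightarrow> nat \<Rightarrow> nat" where
  "substitute N x y z = (if z = 2 * N + 1 - x then 2 * N + 1 - y else if z = x then y else z)"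

lemma substitute_le: "x \<le> 2 * N + 1 \<Longrightarrow> y \<le> 2 * N + 1 \<Longrightarrow> z \<le> 2 * N + 1 \<Longrightarrow>
    substitute N x y z \<le> 2 * N + 1"
  by (simp add: substitute_def)

lemma substitute_negate:
  assumes "x \<le> 2 * N + 1" "y \<le> 2 * N + 1" "z \<le> 2 * N + 1"
  shows "substitute N x y (2 * N + 1 - z) = 2 * N + 1 - substitute N x y z"
proof -
  have "x \<noteq> 2 * N + 1 - x" by presburger
  moreover have "2 * N + 1 - z = 2 * N + 1 - x \<longleftrightarrow> z = x" "2 * N + 1 - z = x \<longleftrightarrow> z = 2 * N + 1 - x"
    using assms by linarith+
  moreover have "2 * N + 1 - (2 * N + 1 - y) = y" using assms by simp
  ultimately show ?thesis unfolding substitute_def by presburger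
qed

text \<open>Different colours for \<open>p\<close> and \<open>q\<close> mean that the literal of
  \<open>p\<close> is the negation of that of \<open>q\<close>, and the substitution identifies the
  two everywhere. If both literals were already equal, all colourings respecting \<open>T\<close>
  agree on \<open>p\<close> and \<open>q\<close>, a contradiction. Otherwise the main point is that
  the new labels assert only relations that the constraints imply.\<close>

lemma labels_sound_insert:
  assumes sound: "labels_sound N T L flag" and pq: "p < N" "q < N"
    and L': "\<And>r. r < N \<Longrightarrow> L' r = substitute N (L p) (2 * N + 1 - L q) (L r)"
    and flag': "flag' = (if L p = L q then 1 else flag)"
  shows "labels_sound N (insert (p, q) T) L' flag'"
proof (cases "flag = 0")
  case False
  then show ?thesis using sound flag' by (auto simp: labels_sound_def)
next
  case True
  let ?M = "2 * N + 1"
  have le: "L r \<le> ?M" if "r < N" for r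
    using sound True that by (auto simp: labels_sound_def)
  have old: "L a + L b = ?M" "a < N" "b < N" if "(a, b) \<in> T" for a b
    using sound True that by (auto simp: labels_sound_def)
  have "\<forall>col :: nat \<Rightarrow> bool. (\<forall>(p, q)\<in>T. col p \<noteq> col q) \<longrightarrow>
      (\<forall>a<N. \<forall>b<N. (L a = L b \<longrightarrow> col a = col b) \<and> (L a + L b = ?M \<longrightarrow> col a \<noteq> col b))"
    using sound unfolding labels_sound_def if_P[OF True] by (elim conjE)
  then have agree: "L a = L b \<Longrightarrow> col a = col b" "L a + L b = ?M \<Longrightarrow> col a \<noteq> col b"
    if "\<forall>(p, q)\<in>T. col p \<noteq> col q" "a < N" "b < N" for col :: "nat \<Rightarrow> bool" and a b
    using that by blast+
  show ?thesis
  proof (cases "L p = L q")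
    case eq: True
    then have "col p = col q" if "\<forall>(p, q)\<in>T. col p \<noteq> col q" for col :: "nat \<Rightarrow> bool"
      using agree(1)[OF that pq] by simp
    then show ?thesis using flag' eq by (auto simp: labels_sound_def)
  next
    case neq: False
    have par: "x \<noteq> ?M - x" for x by presburger
    have neg: "?M - (?M - x) = x" if "x \<le> ?M" for x using that by simp
    have lp: "L p \<le> ?M" and lq: "L q \<le> ?M" using le pq by auto
    have bound: "L' r \<le> ?M" if "r < N" for r
      unfolding L'[OF that] using le[OF that] lp by (intro substitute_le) simp_all
    have neg_L': "L' a + L' b = ?M" if "L a + L b = ?M" "a < N" "b < N" for a b
    proof -
      have "L b = ?M - L a" using that by simp
      then have "L' b = ?M - L' a"
        unfolding L'[OF that(2)] L'[OF that(3)] using le[OF that(2)] lp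
        by (simp only: substitute_negate diff_le_self)
      then show ?thesis using bound[OF that(2)] by simp
    qed
    \<comment> \<open>\<open>L q\<close> survives even if it is already the negation of
      \<open>L p\<close>: it is then replaced by itself.\<close>
    have "L' p = ?M - L q" "L' q = L q"
      using par[of "L p"] neq neg[OF lq] unfolding L'[OF pq(1)] L'[OF pq(2)] substitute_def
      by (metis, metis)
    then have new: "L' p + L' q = ?M" using lq by simp
    have sep: "(L' a = L' b \<longrightarrow> col a = col b) \<and> (L' a + L' b = ?M \<longrightarrow> col a \<noteq> col b)"
      if col: "\<forall>(p, q)\<in>insert (p, q) T. col p \<noteq> col q" and ab: "a < N" "b < N"
      for col :: "nat \<Rightarrow> bool" and a b
    proof -
      have colT: "\<forall>(p, q)\<in>T. col p \<noteq> col q" and colpq: "col p \<noteq> col q" using col by auto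
      \<comment> \<open>Each arc has either been moved to the class of \<open>p\<close> and
        \<open>q\<close>, with the sign of one of them, or kept its label.\<close>
      have cls: "(L' r = ?M - L q \<and> col r = col p) \<or> (L' r = L q \<and> col r = col q) \<or>
          (L' r = L r \<and> L r \<noteq> L p \<and> L r \<noteq> ?M - L p)" if "r < N" for r
      proof -
        consider "L r = ?M - L p" | "L r = L p" | "L r \<noteq> L p" "L r \<noteq> ?M - L p" by blast
        then show ?thesis
        proof cases
          case 1
          then have "L r + L p = ?M" using lp by simp
          then have "col r \<noteq> col p" using agree(2)[OF colT that pq(1)] by simp
          then show ?thesis using 1 lq colpq by (auto simp: L'[OF that] substitute_def)
        next
          case 2
          then have "col r = col p" using agree(1)[OF colT that pq(1)] by simp
          then show ?thesis using 2 par[of "L p"] by (auto simp: L'[OF that] substitute_def)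
        next
          case 3
          then show ?thesis by (auto simp: L'[OF that] substitute_def)
        qed
      qed
      \<comment> \<open>An arc carries a label of the merged class because it was moved there or had
        it before; both origins determine the same colour.\<close>
      have F1: "col r = col p" if "r < N" "L' r = ?M - L q" for r
      proof -
        have "L r = ?M - L q \<Longrightarrow> col r \<noteq> col q"
          using agree(2)[OF colT that(1) pq(2)] lq by simp
        then show ?thesis using cls[OF that(1)] that(2) par[of "L q"] colpq by auto
      qed
      have F2: "col r = col q" if "r < N" "L' r = L q" for r
        using cls[OF that(1)] that(2) par[of "L q"] agree(1)[OF colT that(1) pq(2)] by auto
      have F3: "L' r = L r" if "r < N" "L' r \<noteq> L q" "L' r \<noteq> ?M - L q" for r
        using cls[OF that(1)] that(2,3) by auto
      consider "L' a = ?M - L q" | "L' a = L q" | "L' a \<noteq> L q" "L' a \<noteq> ?M - L q" by blast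
      then show ?thesis
      proof cases
        case 1
        have a: "col a = col p" by (rule F1[OF ab(1) 1])
        show ?thesis
        proof (intro conjI impI)
          assume "L' a = L' b"
          then show "col a = col b" using 1 a F1[OF ab(2)] by simp
        next
          assume "L' a + L' b = ?M"
          then have "L' b = L q" using 1 lq by simp
          then show "col a \<noteq> col b" using a F2[OF ab(2)] colpq by simp
        qed
      next
        case 2
        have a: "col a = col q" by (rule F2[OF ab(1) 2])
        show ?thesis
        proof (intro conjI impI)
          assume "L' a = L' b"
          then show "col a = col b" using 2 a F2[OF ab(2)] by simp
        next
          assume "L' a + L' b = ?M"
          then have "L' b = ?M - L q" using 2 by simp
          then show "col a \<noteq> col b" using a F1[OF ab(2)] colpq by simp
        qed
      next
        case 3
        have a: "L' a = L a" by (rule F3[OF ab(1) 3])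
        show ?thesis
        proof (intro conjI impI)
          assume eq: "L' a = L' b"
          then have "L' b = L b" using 3 by (intro F3[OF ab(2)]) simp_all
          then show "col a = col b" using a eq by (intro agree(1)[OF colT ab]) simp
        next
          assume eq: "L' a + L' b = ?M"
          then have "L' b \<noteq> L q" "L' b \<noteq> ?M - L q" using 3 lq by linarith+
          then have "L' b = L b" by (rule F3[OF ab(2)])
          then show "col a \<noteq> col b" using a eq by (intro agree(2)[OF colT ab]) simp
        qed
      qed
    qed
    have ins: "\<forall>(a, b)\<in>insert (p, q) T. a < N \<and> b < N \<and> L' a + L' b = ?M"
      using new old neg_L' pq by blast
    have flag0: "flag' = 0" using True neq flag' by simp
    show ?thesis
      unfolding labels_sound_def if_P[OF flag0]
    proof (intro conjI)
      show "\<forall>p<N. L' p \<le> ?M" using bound by blast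
      show "\<forall>(p, q)\<in>insert (p, q) T. p < N \<and> q < N \<and> L' p + L' q = ?M" by (rule ins)
    qed (use sep in blast)
  qed
qed

text \<open>The labels are compared before register 19 is turned into the negation of the second
  one. After a contradiction the relabeling goes on, but the flag is never reset, and once it is set
  \<open>labels_sound\<close> asserts nothing about labels.\<close>

definition merge :: com where
  "merge = Get 18 3 15 ;; Get 19 3 17 ;; Equal 22 18 19 ;; When 22 (Assign 10 1) ;;
     Minus 19 11 19 ;; Minus 20 11 18 ;; Minus 21 11 19 ;;
     Loop 24 7 (Get 22 3 24 ;; Equal 23 22 18 ;; Equal 26 22 20 ;;
       When 23 (Put 3 24 19) ;; When 26 (Put 3 24 21))"

lemma wp_relabel_loop:
  assumes "s 7 = N" "s 18 = x" "s 19 = y" "s 20 = 2 * N + 1 - x" "s 21 = 2 * N + 1 - y"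
    and Q: "\<And>s' m'. \<forall>r\<in>{10, 11}. s' r = s r \<Longrightarrow> \<forall>r<N. m' 3 r = substitute N x y (m 3 r) \<Longrightarrow>
      \<forall>k. k \<noteq> 3 \<longrightarrow> m' k = m k \<Longrightarrow> Q s' m' xs"
  shows "wp (Loop 24 7 (Get 22 3 24 ;; Equal 23 22 18 ;; Equal 26 22 20 ;;
       When 23 (Put 3 24 19) ;; When 26 (Put 3 24 21))) Q s m xs"
proof (rule wp_Loop[where R = "{7, 10, 11, 18, 19, 20, 21}" and I = "\<lambda>k s' m' xs'.
      (\<forall>r. m' 3 r = (if r < k then substitute N x y (m 3 r) else m 3 r)) \<and>
      (\<forall>k. k \<noteq> 3 \<longrightarrow> m' k = m k) \<and> xs' = xs"], goal_cases)
  case (4 k s1 m1 xs1)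
  then have s1: "s1 18 = x" "s1 19 = y" "s1 20 = 2 * N + 1 - x" "s1 21 = 2 * N + 1 - y" "s1 24 = k"
      "m1 3 k = m 3 k"
    using assms by auto
  show ?case using 4 s1 by (auto simp: substitute_def less_Suc_eq)
qed (use assms in auto)

lemma wp_merge:
  assumes s: "s 7 = N" "s 11 = 2 * N + 1" "s 15 = p" "s 17 = q" "p < N" "q < N"
    and sound: "labels_sound N T (m 3) (s 10)"
    and Q: "\<And>s' m'. labels_sound N (insert (p, q) T) (m' 3) (s' 10) \<Longrightarrow>
      \<forall>k. k \<noteq> 3 \<longrightarrow> m' k = m k \<Longrightarrow> Q s' m' xs"
  shows "wp merge Q s m xs"
proof -
  have "wp (Loop 24 7 (Get 22 3 24 ;; Equal 23 22 18 ;; Equal 26 22 20 ;;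
       When 23 (Put 3 24 19) ;; When 26 (Put 3 24 21))) Q t m xs"
    if "t 7 = N" "t 18 = m 3 p" "t 19 = 2 * N + 1 - m 3 q" "t 20 = 2 * N + 1 - m 3 p"
      "t 21 = 2 * N + 1 - (2 * N + 1 - m 3 q)" "t 10 = (if m 3 p = m 3 q then 1 else s 10)" for t
  proof (rule wp_relabel_loop[OF that(1-5)])
    fix s' m'
    assume s': "\<forall>r\<in>{10, 11}. s' r = t r"
      and m': "\<forall>r<N. m' 3 r = substitute N (m 3 p) (2 * N + 1 - m 3 q) (m 3 r)"
        "\<forall>k. k \<noteq> 3 \<longrightarrow> m' k = m k"
    have "labels_sound N (insert (p, q) T) (m' 3) (s' 10)"
      using m'(1) s' that(6) by (intro labels_sound_insert[OF sound s(5,6)]) simp_all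
    then show "Q s' m' xs" using m'(2) by (rule Q)
  qed
  then show ?thesis using s(1-4) by (simp add: merge_def)
qed

text \<open>Registers 2 to 6 run over \<open>u\<close>, \<open>v\<close>, \<open>a\<close>,
  \<open>b\<close>, \<open>c\<close>; register 14 collects the left side of the distance equation.
  The nested conditionals express a conjunction, in which a positive entry of array 1 stands for a
  finite bound.\<close>

definition separate :: com where
  "separate = Loop 2 0 (Loop 3 0 (Loop 4 0 (Loop 5 0 (Loop 6 0 (
     Encode_Pair 12 2 3 ;; Get 13 1 12 ;; Encode_Pair 15 4 5 ;; Get 16 0 15 ;; Encode_Pair 17 5 6 ;; Get 18 0 17 ;;
     Get 19 2 12 ;; Encode_Pair 20 2 4 ;; Get 14 2 20 ;; Encode_Pair 21 6 3 ;; Get 9 2 21 ;; Plus 14 14 9 ;;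
     Assign 9 2 ;; Plus 14 14 9 ;; Equal 22 14 19 ;;
     When 13 (When 16 (When 18 (When 22 merge))))))))"

text \<open>A singleton or empty set per choice of indices, so that the constraints form the union
  that \<open>wp_Loop_Union\<close> accumulates.\<close>

definition separated ::
  "(nat \<Rightarrow> nat \<Rightarrow> nat) \<Rightarrow> nat \<Rightarrow> nat \<Rightarrow> nat \<Rightarrow> nat \<Rightarrow> nat \<Rightarrow> (nat \<times> nat) set"
where
  "separated m u v a b c =
     (if m 1 (pair_code u v) > 0 \<and> m 0 (pair_code a b) > 0 \<and> m 0 (pair_code b c) > 0 \<and>
         m 2 (pair_code u a) + m 2 (pair_code c v) + 2 = m 2 (pair_code u v)
      then {(pair_code a b, pair_code b c)} else {})"

lemma wp_separate:
  assumes s: "s 0 = n" "s 7 = pair_code n n" "s 11 = 2 * pair_code n n + 1" "s 10 = 0"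
    and L: "\<forall>p<pair_code n n. m 3 p = p"
    and Q: "\<And>s' m'. s' 10 = 0 \<longleftrightarrow> (\<exists>col :: nat \<Rightarrow> bool.
      \<forall>(p, q)\<in>(\<Union>u<n. \<Union>v<n. \<Union>a<n. \<Union>b<n. \<Union>c<n. separated m u v a b c). col p \<noteq> col q) \<Longrightarrow>
      Q s' m' xs"
  shows "wp separate Q s m xs"
proof -
  let ?N = "pair_code n n"
  define P where "P T s' m' xs' \<longleftrightarrow> labels_sound ?N T (m' 3) (s' 10) \<and>
      (\<forall>k. k \<noteq> 3 \<longrightarrow> m' k = m k) \<and> xs' = xs"
    for T and s' :: "nat \<Rightarrow> nat" and m' xs'
  let ?T = "\<lambda>u v a b c. separated m u v a b c"
  let ?body = "Encode_Pair 12 2 3 ;; Get 13 1 12 ;; Encode_Pair 15 4 5 ;; Get 16 0 15 ;; Encode_Pair 17 5 6 ;;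
     Get 18 0 17 ;; Get 19 2 12 ;; Encode_Pair 20 2 4 ;; Get 14 2 20 ;; Encode_Pair 21 6 3 ;; Get 9 2 21 ;;
     Plus 14 14 9 ;; Assign 9 2 ;; Plus 14 14 9 ;; Equal 22 14 19 ;;
     When 13 (When 16 (When 18 (When 22 merge)))"
  have st: "static R merge" if "R \<subseteq> {0, 2, 7, 3, 4, 5, 6, 11}" "7 \<in> R" for R
    using that by (auto simp: merge_def)
  have body: "wp ?body (P (T \<union> ?T u v a b c)) t m' xs'"
    if P: "P T t m' xs'" and t: "t 7 = ?N" "t 11 = 2 * ?N + 1"
      "t 2 = u" "t 3 = v" "t 4 = a" "t 5 = b" "t 6 = c"
      and lt: "a < n" "b < n" "c < n" for T t m' xs' u v a b c
  proof -
    have m': "m' k = m k" if "k \<noteq> 3" for k using P that by (simp add: P_def)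
    have "wp merge (P (insert (pair_code a b, pair_code b c) T)) t' m' xs'"
      if "t' 7 = ?N" "t' 11 = 2 * ?N + 1" "t' 15 = pair_code a b" "t' 17 = pair_code b c"
        "t' 10 = t 10" for t'
      by (rule wp_merge[OF that(1-4) pair_code_less[OF lt(1,2)] pair_code_less[OF lt(2,3)]])
        (use P that(5) in \<open>auto simp: P_def\<close>)
    moreover have "P T t' m' xs'" if "t' 10 = t 10" for t'
      using P that by (simp add: P_def)
    ultimately show ?thesis
      using t by (simp add: m' separated_def)
  qed
  have "wp separate (P ({} \<union> (\<Union>u<s 0. \<Union>v<n. \<Union>a<n. \<Union>b<n. \<Union>c<n. ?T u v a b c))) s m xs"
    unfolding separate_def
  proof (rule wp_Loop_Union[where R = "{0, 7, 11}"], goal_cases)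
    case (4 u T1 s1 m1 xs1)
    then have s1: "s1 0 = n" "s1 7 = ?N" "s1 11 = 2 * ?N + 1" "s1 2 = u" using s by auto
    have "wp (Loop 3 0 (Loop 4 0 (Loop 5 0 (Loop 6 0 ?body))))
       (P (T1 \<union> (\<Union>v<s1 0. \<Union>a<n. \<Union>b<n. \<Union>c<n. ?T u v a b c))) s1 m1 xs1"
    proof (rule wp_Loop_Union[where R = "{0, 2, 7, 11}"], goal_cases)
      case (4 v T2 s2 m2 xs2)
      then have s2: "s2 0 = n" "s2 7 = ?N" "s2 11 = 2 * ?N + 1" "s2 2 = u" "s2 3 = v"
        using s1 by auto
      have "wp (Loop 4 0 (Loop 5 0 (Loop 6 0 ?body)))
         (P (T2 \<union> (\<Union>a<s2 0. \<Union>b<n. \<Union>c<n. ?T u v a b c))) s2 m2 xs2"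
      proof (rule wp_Loop_Union[where R = "{0, 2, 7, 3, 11}"], goal_cases)
        case (4 a T3 s3 m3 xs3)
        then have s3: "s3 0 = n" "s3 7 = ?N" "s3 11 = 2 * ?N + 1" "s3 2 = u" "s3 3 = v"
          "s3 4 = a" "a < n"
          using s2 by auto
        have "wp (Loop 5 0 (Loop 6 0 ?body))
           (P (T3 \<union> (\<Union>b<s3 0. \<Union>c<n. ?T u v a b c))) s3 m3 xs3"
        proof (rule wp_Loop_Union[where R = "{0, 2, 7, 3, 4, 11}"], goal_cases)
          case (4 b T4 s4 m4 xs4)
          then have s4: "s4 0 = n" "s4 7 = ?N" "s4 11 = 2 * ?N + 1" "s4 2 = u" "s4 3 = v"
            "s4 4 = a" "s4 5 = b" "b < n"
            using s3 by auto
          have "wp (Loop 6 0 ?body) (P (T4 \<union> (\<Union>c<s4 0. ?T u v a b c))) s4 m4 xs4"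
          proof (rule wp_Loop_Union[where R = "{0, 2, 7, 3, 4, 5, 11}"], goal_cases)
            case (4 c T5 s5 m5 xs5)
            then show ?case using s4 s3(7) by (intro body) auto
          qed (use 4 st in \<open>auto simp: P_def\<close>)
          then show ?case by (simp add: s4)
        qed (use 4 st in \<open>auto simp: P_def\<close>)
        then show ?case by (simp add: s3)
      qed (use 4 st in \<open>auto simp: P_def\<close>)
      then show ?case by (simp add: s2)
    qed (use 4 st in \<open>auto simp: P_def\<close>)
    then show ?case by (simp add: s1)
  next
    case 3
    \<comment> \<open>The initial labels are distinct and any two sum to less than
      \<open>2 * N + 1\<close>, so they relate no two different arcs.\<close>
    have "labels_sound ?N {} (m 3) 0" using L by (auto simp: labels_sound_def)
    then show ?case using s by (simp add: P_def)
  qed (use st in \<open>auto simp: P_def\<close>)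
  then show ?thesis
    by (rule wp_mono) (use s in \<open>auto simp: P_def intro!: Q dest!: labels_sound_final\<close>)
qed

section \<open>The decision procedure\<close>

text \<open>Kept apart from \<open>main\<close> because \<open>main\<close> uses register 7 as a
  loop limit, which must be computed beforehand to count among the unwritten registers.\<close>

definition prelude :: com where
  "prelude = Encode_Pair 7 0 0 ;; Assign 9 1 ;; Plus 11 7 7 ;; Plus 11 11 9"

definition main :: com where
  "main = read_matrix 0 ;; read_matrix 1 ;; dist_init ;; relax ;; label_init ;; separate"

text \<open>Adjacency is tied to \<open>d\<close> only at the values 0 and 1, which makes the
  initial matrix exact there; the remaining hypotheses drive the relaxation.\<close>

lemma wp_main:
  fixes A B d :: "nat \<Rightarrow> nat \<Rightarrow> nat"
  assumes s: "s 0 = n" "s 7 = pair_code n n" "s 11 = 2 * pair_code n n + 1" "s 10 = 0"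
    and xs: "xs = flatten n A @ flatten n B @ rest"
    and refl: "\<And>i. i < n \<Longrightarrow> d i i = 0"
    and zero: "\<And>i j. i < n \<Longrightarrow> j < n \<Longrightarrow> d i j = 0 \<Longrightarrow> i = j"
    and arc: "\<And>i j. i < n \<Longrightarrow> j < n \<Longrightarrow> A i j > 0 \<Longrightarrow> d i j \<le> 1"
    and one: "\<And>i j. i < n \<Longrightarrow> j < n \<Longrightarrow> d i j = 1 \<Longrightarrow> A i j > 0"
    and tri: "\<And>i j k. i < n \<Longrightarrow> j < n \<Longrightarrow> k < n \<Longrightarrow> d i j \<le> d i k + d k j"
    and decomp: "\<And>i j l. i < n \<Longrightarrow> j < n \<Longrightarrow> d i j = Suc (Suc l) \<Longrightarrow>
      \<exists>k<n. d i k = Suc l \<and> d k j \<le> 1"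
    and less: "\<And>i j. i < n \<Longrightarrow> j < n \<Longrightarrow> d i j < n"
  shows "wp main (\<lambda>s' m' xs'. s' 10 = 0 \<longleftrightarrow> (\<exists>col :: nat \<Rightarrow> bool.
      \<forall>u<n. \<forall>v<n. \<forall>a<n. \<forall>b<n. \<forall>c<n. B u v > 0 \<and> A a b > 0 \<and> A b c > 0 \<and>
        d u a + 2 + d c v = d u v \<longrightarrow> col (pair_code a b) \<noteq> col (pair_code b c))) s m xs"
proof -
  let ?Q = "\<lambda>s' m' xs'. s' 10 = 0 \<longleftrightarrow> (\<exists>col :: nat \<Rightarrow> bool.
      \<forall>u<n. \<forall>v<n. \<forall>a<n. \<forall>b<n. \<forall>c<n. B u v > 0 \<and> A a b > 0 \<and> A b c > 0 \<and>
        d u a + 2 + d c v = d u v \<longrightarrow> col (pair_code a b) \<noteq> col (pair_code b c))"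
  have "wp (read_matrix 0) (wp (read_matrix 1) (wp dist_init (wp relax (wp label_init (wp separate ?Q))))) s m xs"
  proof (rule wp_read_matrix[where f = A and n = n and rest = "flatten n B @ rest"])
    fix s1 :: "nat \<Rightarrow> nat" and m1 :: "nat \<Rightarrow> nat \<Rightarrow> nat"
    assume s1: "\<forall>r\<in>{0, 7, 10, 11}. s1 r = s r"
      and m1: "\<forall>i<n. \<forall>j<n. m1 0 (pair_code i j) = A i j"
    show "wp (read_matrix 1) (wp dist_init (wp relax (wp label_init (wp separate
      ?Q)))) s1 m1
      (flatten n B @ rest)"
    proof (rule wp_read_matrix[where f = B and n = n and rest = rest])
      fix s2 :: "nat \<Rightarrow> nat" and m2 :: "nat \<Rightarrow> nat \<Rightarrow> nat"
      assume s2: "\<forall>r\<in>{0, 7, 10, 11}. s2 r = s1 r"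
        and m2: "\<forall>i<n. \<forall>j<n. m2 1 (pair_code i j) = B i j" "\<forall>k. k \<noteq> 1 \<longrightarrow> m2 k = m1 k"
      show "wp dist_init (wp relax (wp label_init (wp separate
        ?Q))) s2 m2 rest"
      proof (rule wp_dist_init)
        fix s3 :: "nat \<Rightarrow> nat" and m3 :: "nat \<Rightarrow> nat \<Rightarrow> nat"
        assume s3: "\<forall>r\<in>{0, 7, 10, 11}. s3 r = s2 r"
          and m3: "\<forall>i<n. \<forall>j<n. m3 2 (pair_code i j) =
              (if i = j then 0 else if m2 0 (pair_code i j) > 0 then 1 else n)"
            "\<forall>k. k \<noteq> 2 \<longrightarrow> m3 k = m2 k"
        have init: "d i j \<le> m3 2 (pair_code i j) \<and> (d i j \<le> 1 \<longrightarrow> m3 2 (pair_code i j) = d i j)"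
          if "i < n" "j < n" for i j
        proof -
          have D: "m3 2 (pair_code i j) = (if i = j then 0 else if A i j > 0 then 1 else n)"
            using m3(1) m2(2) m1 that by simp
          show ?thesis
            using refl[OF that(1)] zero[OF that] arc[OF that] one[OF that] less[OF that]
            unfolding D by (cases "d i j = 0"; cases "d i j = 1") auto
        qed
        show "wp relax (wp label_init (wp separate
          ?Q)) s3 m3 rest"
        proof (rule wp_relax[where n = n and d = d])
          fix s4 :: "nat \<Rightarrow> nat" and m4 :: "nat \<Rightarrow> nat \<Rightarrow> nat"
          assume s4: "\<forall>r\<in>{0, 7, 10, 11}. s4 r = s3 r"
            and m4: "\<forall>i<n. \<forall>j<n. m4 2 (pair_code i j) = d i j" "\<forall>k. k \<noteq> 2 \<longrightarrow> m4 k = m3 k"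
          show "wp label_init (wp separate
            ?Q) s4 m4 rest"
          proof (rule wp_label_init)
            fix s5 :: "nat \<Rightarrow> nat" and m5 :: "nat \<Rightarrow> nat \<Rightarrow> nat"
            assume s5: "\<forall>r\<in>{0, 7, 10, 11}. s5 r = s4 r"
              and m5: "\<forall>p<s4 7. m5 3 p = p" "\<forall>k. k \<noteq> 3 \<longrightarrow> m5 k = m4 k"
            have regs: "s5 0 = n" "s5 7 = pair_code n n" "s5 11 = 2 * pair_code n n + 1" "s5 10 = 0"
              "s4 7 = pair_code n n"
              using s s1 s2 s3 s4 s5 by simp_all
            have arrays: "m5 0 (pair_code i j) = A i j" "m5 1 (pair_code i j) = B i j"
              "m5 2 (pair_code i j) = d i j" if "i < n" "j < n" for i j
              using m1 m2 m3 m4 m5 that by simp_all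
            have sep: "(\<forall>(p, q)\<in>separated m5 u v a b c. col p \<noteq> col q) \<longleftrightarrow>
                (B u v > 0 \<and> A a b > 0 \<and> A b c > 0 \<and> d u a + 2 + d c v = d u v \<longrightarrow>
                  col (pair_code a b) \<noteq> col (pair_code b c))"
              if "u < n" "v < n" "a < n" "b < n" "c < n" for u v a b c and col :: "nat \<Rightarrow> bool"
              using arrays(2,3)[OF that(1,2)] arrays(1)[OF that(3,4)] arrays(1)[OF that(4,5)]
                arrays(3)[OF that(1,3)] arrays(3)[OF that(5,2)]
              by (simp add: separated_def)
            have lt: "(\<forall>x\<in>{..<n}. R x) \<longleftrightarrow> (\<forall>x<n. R x)" for R by auto
            have eq: "(\<forall>(p, q)\<in>(\<Union>u<n. \<Union>v<n. \<Union>a<n. \<Union>b<n. \<Union>c<n. separated m5 u v a b c).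
                 col p \<noteq> col q) \<longleftrightarrow>
               (\<forall>u<n. \<forall>v<n. \<forall>a<n. \<forall>b<n. \<forall>c<n. B u v > 0 \<and> A a b > 0 \<and> A b c > 0 \<and>
                  d u a + 2 + d c v = d u v \<longrightarrow> col (pair_code a b) \<noteq> col (pair_code b c))"
              for col :: "nat \<Rightarrow> bool"
              by (simp only: ball_UN lt sep cong: imp_cong)
            show "wp separate ?Q s5 m5 rest"
            proof (rule wp_separate[OF regs(1-4)])
              show "\<forall>p<pair_code n n. m5 3 p = p" using m5(1) regs(5) by simp
            qed (simp only: eq)
          qed
        qed (use s s1 s2 s3 in simp, (fact tri decomp less init)+)
      qed (use s s1 s2 in simp)
    qed (use s s1 in simp_all)
  qed (use s xs in simp_all)
  then show ?thesis by (simp only: main_def wp_simps)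
qed

text \<open>The last jump leads to rejection if register 10 is set; otherwise control falls through
  to acceptance.\<close>

definition program :: "instr list" where
  "program = (let a = length (compile 0 (Input 0));
      b = a + length (compile a prelude);
      e = b + length (compile b main) in
    compile 0 (Input 0) @ compile a prelude @ compile b main @
    [JumpPos (e + 2) 10, Halt True, Halt False])"

section \<open>Halting and running time of the assembled program\<close>

lemma halted_steps: "(step P ^^ t) (Halted b) = Halted b"
  by (induction t) simp_all

lemma reaches_Halted: "reaches P t c (Halted b) \<Longrightarrow> (step P ^^ t) c = Halted b"
proof -
  assume "reaches P t c (Halted b)"
  then obtain t' where "t' \<le> t" "(step P ^^ t') c = Halted b" by (auto simp: reaches_def)
  then have "(step P ^^ (t - t' + t')) c = Halted b"
    unfolding funpow_add by (simp add: halted_steps)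
  then show ?thesis using \<open>t' \<le> t\<close> by simp
qed

text \<open>The 3 extra steps are the reading of \<open>n\<close> and the final jump and halt. As
  \<open>n\<close> is at most \<open>pair_code n n\<close>, this value bounds the entry limits of
  both compiled parts.\<close>

lemma program_reaches:
  assumes "wp main (\<lambda>s m ys. s 10 = 0 \<longleftrightarrow> r)
      (fst (run prelude ((\<lambda>_. 0)(0 := n), \<lambda>_ _. 0, xs))) (\<lambda>_ _. 0) xs"
  shows "reaches program
     (time_bound prelude (pair_code n n) + time_bound main (pair_code n n) + 3)
     (initial (n # xs)) (Halted r)"
proof -
  define a where "a = length (compile 0 (Input 0))"
  define b where "b = a + length (compile a prelude)"
  define e where "e = b + length (compile b main)"
  let ?N = "pair_code n n"
  have code: "code_at program 0 (program @ [])" by (simp add: code_at_def)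
  then have code: "code_at program 0 (compile 0 (Input 0))" "code_at program a (compile a prelude)"
      "code_at program b (compile b main)" "code_at program e [JumpPos (e + 2) 10, Halt True, Halt False]"
    unfolding program_def Let_def code_at_append
    by (simp_all add: a_def b_def e_def program_def Let_def)
  define \<sigma>0 :: store where "\<sigma>0 = (\<lambda>_. 0, \<lambda>_ _. 0, n # xs)"
  define \<sigma>1 :: store where "\<sigma>1 = ((\<lambda>_. 0)(0 := n), \<lambda>_ _. 0, xs)"
  have r0: "represents \<sigma>0 (\<lambda>_. 0) (n # xs)" by (simp add: represents_def \<sigma>0_def)
  have "run (Input 0) \<sigma>0 = \<sigma>1" by (simp add: \<sigma>0_def \<sigma>1_def fun_eq_iff)
  with compile_correct[OF code(1) _ _ r0, of "{}" ?N] obtain X1 xs1 where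
    1: "represents \<sigma>1 X1 xs1" "reaches program 1 (initial (n # xs)) (Running a X1 xs1)"
    by (auto simp: a_def initial_def)
  have N: "n \<le> ?N" by (simp add: pair_code_def)
  have st: "static {0} prelude" by (simp add: prelude_def)
  have run: "run prelude \<sigma>1 = (fst (run prelude \<sigma>1), \<lambda>_ _. 0, xs)"
      and regs: "fst (run prelude \<sigma>1) 0 = n" "fst (run prelude \<sigma>1) 7 = ?N"
  proof -
    have "wp prelude (\<lambda>s m ys. s 0 = n \<and> s 7 = ?N \<and> m = (\<lambda>_ _. 0) \<and> ys = xs)
        ((\<lambda>_. 0)(0 := n)) (\<lambda>_ _. 0) xs"
      by (simp add: prelude_def)
    then show "run prelude \<sigma>1 = (fst (run prelude \<sigma>1), \<lambda>_ _. 0, xs)"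
        "fst (run prelude \<sigma>1) 0 = n" "fst (run prelude \<sigma>1) 7 = ?N"
      by (auto simp: wp_def \<sigma>1_def split: prod.splits)
  qed
  obtain X2 xs2 where 2: "represents (run prelude \<sigma>1) X2 xs2"
      "reaches program (time_bound prelude ?N) (Running a X1 xs1) (Running b X2 xs2)"
    using compile_correct[OF code(2) st _ 1(1), of ?N] N by (auto simp: b_def \<sigma>1_def)
  have st: "static {0, 7} main"
    by (simp add: main_def read_matrix_def dist_init_def relax_def label_init_def separate_def merge_def)
  obtain X3 xs3 where 3: "represents (run main (run prelude \<sigma>1)) X3 xs3"
      "reaches program (time_bound main ?N) (Running b X2 xs2) (Running e X3 xs3)"
    using compile_correct[OF code(3) st _ 2(1), of ?N] regs N by (auto simp: e_def)
  have "fst (run main (run prelude \<sigma>1)) 10 = 0 \<longleftrightarrow> r"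
    using assms by (subst run) (simp add: wp_def \<sigma>1_def split_beta)
  then have X3: "X3 10 = 0 \<longleftrightarrow> r" using 3(1) by (simp add: represents_def)
  have "(step program ^^ 2) (Running e X3 xs3) = Halted r"
    using code(4) X3 by (cases r) (simp_all add: funpow_few)
  then have "reaches program 2 (Running e X3 xs3) (Halted r)"
    by (rule reaches_funpow) simp
  from reaches_trans[OF 1(2) reaches_trans[OF 2(2) reaches_trans[OF 3(2) this]]] show ?thesis
    by (rule reaches_mono) simp
qed

section \<open>From machine inputs back to graphs\<close>

lemma encode_eq:
  "encode J = card (pverts (graph J)) #
     flatten (card (pverts (graph J))) (\<lambda>u v. if (u, v) \<in> parcs (graph J) then 1 else 0) @
     flatten (card (pverts (graph J))) (\<lambda>u v. encode_bound (bound J u v)) @ [period J]"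
  by (simp add: encode_def flatten_def Let_def)

lemma length_le_input_size: "length xs \<le> input_size xs"
  unfolding input_size_def by (induction xs) auto

lemma poly_mono_nat: "a \<le> b \<Longrightarrow> poly (p :: nat poly) a \<le> poly p b"
  by (induction p) (auto intro!: add_mono mult_mono)

theorem theorem10:
  shows "poly_time_decidable encode
    {J \<in> DiTGR. period J = 2 \<and> geodetic (graph J) \<and> dist_or_infinity J} ditgr_yes"
proof -
  obtain p q :: "nat poly"
    where p: "\<And>N. poly p N = time_bound prelude N" and q: "\<And>N. poly q N = time_bound main N"
    using time_bound_poly by metis
  \<comment> \<open>The inner polynomial \<open>x + 4 x^2\<close> is \<open>pair_code x x\<close>;
    the outer one bounds the steps in terms of that value.\<close>
  define B where "B = pcompose (p + q + [:3:]) [:0, 1, 4:]"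
  have "halts_within program (encode J) (poly B (input_size (encode J))) (ditgr_yes J)"
    if J: "J \<in> DiTGR" "period J = 2" "geodetic (graph J)" "dist_or_infinity J" for J
  proof -
    let ?G = "graph J"
    obtain n where V: "pverts ?G = {0..<n}" using J(1) by (auto simp: DiTGR_def)
    have inst: "ditgr_instance J" using J(1) by (simp add: DiTGR_def)
    interpret pair_fin_digraph ?G using inst by (simp add: ditgr_instance_def)
    have reach: "u \<rightarrow>\<^sup>*\<^bsub>with_proj ?G\<^esub> v" if "u < n" "v < n" for u v
      using that inst V by (auto simp: ditgr_instance_def strongly_connected_def)
    define A where "A u v = (if (u, v) \<in> parcs ?G then 1 else 0 :: nat)" for u v
    define D where "D u v = encode_bound (bound J u v)" for u v
    define rest where "rest = flatten n A @ flatten n D @ [2]"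
    have enc: "encode J = n # rest"
      using V J(2) by (simp add: encode_eq A_def[abs_def] D_def[abs_def] rest_def)
    have D_pos: "D u v > 0 \<longleftrightarrow> bound J u v \<noteq> \<infinity>" for u v
      by (auto simp: D_def encode_bound_def split: enat.splits)
    have A_pos: "A u v > 0 \<longleftrightarrow> (u, v) \<in> parcs ?G" for u v by (simp add: A_def)
    have Vn: "u \<in> pverts ?G \<longleftrightarrow> u < n" for u by (simp add: V)
    have arc_less: "a < n" "b < n" if "(a, b) \<in> parcs ?G" for a b
      using wellformed[of "(a, b)"] that V by auto
    let ?P = "\<lambda>col :: nat \<Rightarrow> bool. \<forall>u<n. \<forall>v<n. \<forall>a<n. \<forall>b<n. \<forall>c<n. D u v > 0 \<and> A a b > 0 \<and> A b c > 0 \<and>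
        hops ?G u a + 2 + hops ?G c v = hops ?G u v \<longrightarrow> col (pair_code a b) \<noteq> col (pair_code b c)"
    have yes: "ditgr_yes J \<longleftrightarrow> (\<exists>col. ?P col)"
    proof -
      have forcedI: "((a, b), (b, c)) \<in> forced_pairs J"
        if "u < n" "v < n" "D u v > 0 \<and> A a b > 0 \<and> A b c > 0 \<and>
          hops ?G u a + 2 + hops ?G c v = hops ?G u v" for u v a b c
        unfolding forced_pairs_def mem_Collect_eq
        by (rule exI[of _ u], rule exI[of _ v], rule exI[of _ a], rule exI[of _ b], rule exI[of _ c])
          (use that in \<open>simp add: D_pos A_pos Vn del: not_infinity_eq\<close>)
      \<comment> \<open>Colourings of arcs and of codes translate into each other because the code
        is injective; \<open>inv\<close> decodes.\<close>
      let ?C = "\<lambda>(a, b). pair_code a b"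
      have inj: "inj ?C" by (auto simp: inj_def)
      have "(\<exists>col. \<forall>(e, f)\<in>forced_pairs J. col e \<noteq> (col f :: bool)) \<longleftrightarrow> (\<exists>col. ?P col)"
      proof
        assume "\<exists>col. \<forall>(e, f)\<in>forced_pairs J. col e \<noteq> (col f :: bool)"
        then obtain col :: "nat \<times> nat \<Rightarrow> bool"
          where col: "\<And>e f. (e, f) \<in> forced_pairs J \<Longrightarrow> col e \<noteq> col f" by blast
        have inv: "inv ?C (pair_code a b) = (a, b)" for a b
          using inv_f_f[OF inj, of "(a, b)"] by simp
        have "?P (\<lambda>x. col (inv ?C x))"
        proof (intro allI impI)
          fix u v a b c
          assume "u < n" "v < n" "a < n" "b < n" "c < n" "D u v > 0 \<and> A a b > 0 \<and> A b c > 0 \<and>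
            hops ?G u a + 2 + hops ?G c v = hops ?G u v"
          then have "((a, b), (b, c)) \<in> forced_pairs J" by (intro forcedI)
          from col[OF this] show "col (inv ?C (pair_code a b)) \<noteq> col (inv ?C (pair_code b c))"
            unfolding inv .
        qed
        then show "\<exists>col. ?P col" by (rule exI[of ?P "\<lambda>x. col (inv ?C x)"])
      next
        assume "\<exists>col. ?P col"
        then obtain col where col: "?P col" ..
        have "col (?C e) \<noteq> col (?C f)" if ef: "(e, f) \<in> forced_pairs J" for e f
        proof -
          obtain u v a b c where ef': "e = (a, b)" "f = (b, c)" and uv: "u \<in> pverts ?G" "v \<in> pverts ?G"
            "bound J u v \<noteq> \<infinity>" and arcs: "(a, b) \<in> parcs ?G" "(b, c) \<in> parcs ?G"
            and len: "hops ?G u a + 2 + hops ?G c v = hops ?G u v"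
            using ef unfolding forced_pairs_def mem_Collect_eq prod.inject by blast
          have "u < n" "v < n" "a < n" "b < n" "c < n" using uv arcs arc_less Vn by blast+
          moreover have "D u v > 0 \<and> A a b > 0 \<and> A b c > 0 \<and> hops ?G u a + 2 + hops ?G c v = hops ?G u v"
            using uv(3) arcs len D_pos A_pos by blast
          ultimately have "col (pair_code a b) \<noteq> col (pair_code b c)"
            using col by blast
          then show ?thesis by (simp add: ef')
        qed
        then have "\<forall>(e, f)\<in>forced_pairs J. col (?C e) \<noteq> col (?C f)" by blast
        then show "\<exists>col. \<forall>(e, f)\<in>forced_pairs J. col e \<noteq> (col f :: bool)"
          by (intro exI[of _ "\<lambda>e. col (?C e)"])
      qed
      then show ?thesis using ditgr_yes_iff[OF inst J(2-4)] by simp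
    qed
    have walk0: "u = v" if "u < n" "v < n" "hops ?G u v = 0" for u v
      using ex_shortest_apath[OF reach[OF that(1,2)]] that(3) by (auto simp: apath_Nil_iff)
    have "wp main (\<lambda>s m ys. s 10 = 0 \<longleftrightarrow> ditgr_yes J)
        (fst (run prelude ((\<lambda>_. 0)(0 := n), \<lambda>_ _. 0, rest))) (\<lambda>_ _. 0) rest"
      unfolding yes
    proof (rule wp_main)
      let ?s = "fst (run prelude ((\<lambda>_. 0)(0 := n), \<lambda>_ _. 0, rest))"
      have "wp prelude (\<lambda>s m ys. s 0 = n \<and> s 7 = pair_code n n \<and> s 11 = 2 * pair_code n n + 1 \<and>
          s 10 = 0) ((\<lambda>_. 0)(0 := n)) (\<lambda>_ _. 0) rest"
        by (simp add: prelude_def)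
      then show "?s 0 = n" "?s 7 = pair_code n n" "?s 11 = 2 * pair_code n n + 1" "?s 10 = 0"
        by (auto simp: wp_def split: prod.splits)
      show "rest = flatten n A @ flatten n D @ [2]" by (simp add: rest_def)
      show "hops ?G i i = 0" if "i < n" for i using hops_self that V by simp
      show "i = j" if "i < n" "j < n" "hops ?G i j = 0" for i j using walk0 that by blast
      show "hops ?G i j \<le> 1" if "i < n" "j < n" "A i j > 0" for i j
        using that hops_arc_le[of i j] by (auto simp: A_def split: if_splits)
      show "A i j > 0" if ij: "i < n" "j < n" "hops ?G i j = 1" for i j
      proof -
        obtain w where "(w, j) \<in> parcs ?G" "hops ?G i w = 0"
          using hops_SucE[OF reach[OF ij(1,2)], of 0] ij(3) by auto
        then show ?thesis using walk0[of i w] ij arc_less by (auto simp: A_def)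
      qed
      show "hops ?G i j \<le> hops ?G i k + hops ?G k j" if "i < n" "j < n" "k < n" for i j k
        using hops_triangle reach that by blast
      show "\<exists>k<n. hops ?G i k = Suc l \<and> hops ?G k j \<le> 1"
        if ij: "i < n" "j < n" "hops ?G i j = Suc (Suc l)" for i j l
      proof -
        obtain w where "(w, j) \<in> parcs ?G" "hops ?G i w = Suc l"
          using hops_SucE[OF reach[OF ij(1,2)] ij(3)] by blast
        then show ?thesis using arc_less hops_arc_le by blast
      qed
      show "hops ?G i j < n" if "i < n" "j < n" for i j
        using hops_less_card[OF reach[OF that]] V by simp
    qed
    from program_reaches[OF this]
    have r: "reaches program (time_bound prelude (pair_code n n) + time_bound main (pair_code n n) + 3)
        (initial (encode J)) (Halted (ditgr_yes J))"
      by (simp add: enc)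
    \<comment> \<open>The number \<open>n\<close> alone may be exponential in its bit length; the
      \<open>n * n\<close> matrix entries, each of size at least one, keep it below the input
      size.\<close>
    have "n \<le> input_size (encode J)"
    proof -
      have "n \<le> length (flatten n A)"
        by (simp add: flatten_def length_concat comp_def sum_list_triv)
      also have "\<dots> \<le> length (encode J)" by (simp add: enc rest_def)
      also have "\<dots> \<le> input_size (encode J)" by (rule length_le_input_size)
      finally show ?thesis .
    qed
    then have "poly B n \<le> poly B (input_size (encode J))" by (rule poly_mono_nat)
    moreover have "poly B n = time_bound prelude (pair_code n n) + time_bound main (pair_code n n) + 3"
    proof -
      have "poly [:0, 1, 4:] n = pair_code n n" by (simp add: pair_code_def algebra_simps)
      then show ?thesis by (simp only: B_def poly_pcompose poly_add p q) simp
    qed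
    ultimately show ?thesis
      using reaches_Halted[OF reaches_mono[OF r]] by (simp add: halts_within_def)
  qed
  then show ?thesis unfolding poly_time_decidable_def by blast
qed

end
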